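(* Consider the cell network $\dot{x}_i=f(x_i,u_i)$, $y_i=h(x_i)$, $i=1,\ldots,N$, $u=Py$, described in the context, an equitable partition $O_1,\ldots,O_r$ of the vertices of its contact graph with quotient matrix $\overline{P}$, and a solution $z=(z_1,\ldots,z_r)$ of $z=\overline{P}\,[T(z_1),\ldots,T(z_r)]^T$. Assume that for each $j=1,\ldots,r$ the linearized cell system $(A_j,B_j,C_j)$ at $(S(z_j),z_j)$ has $A_j$ Hurwitz and is observable, and let $\gamma_j$ be its $\mathcal{L}_2$-gain. Let $\Gamma\in\mathbb{R}^{N\times N}$ be the diagonal matrix with $\{\Gamma\}_{kk}=\gamma_j$ for $k\in O_j$. Then the steady state pattern $x_i=S(u_i)$, $i=1,\ldots,N$, where $u_i=z_j$ if $i\in O_j$, is locally asymptotically stable for the network if $$\rho(P\Gamma)<1,$$ where $\rho$ denotes the spectral radius.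
   Context: Contact graph: $\mathcal{G}=\mathcal{G}(V,E)$ is a finite, connected, undirected graph on vertices $\{1,\ldots,N\}$ with symmetric nonnegative weights $w_{i,j}=w_{j,i}$, with $w_{i,j}=0$ exactly when $i,j$ are not adjacent. The node degrees are $d_i=\sum_j w_{i,j}$, which are positive. The scaled adjacency matrix is $P=(p_{ij})\in\mathbb{R}^{N\times N}$, $p_{ij}=d_i^{-1}w_{i,j}$. Equitable partition: a partition of $V$ into nonempty classes $O_1,\ldots,O_r$ is equitable if there exist numbers $\overline{p}_{ij}$ such that $\sum_{v\in O_j}p_{uv}=\overline{p}_{ij}$ for all $u\in O_i$, $i,j=1,\ldots,r$. The quotient matrix is $\overline{P}=(\overline{p}_{ij})\in\mathbb{R}^{r\times r}$. Cell network: identical cells $i=1,\ldots,N$ with dynamics $\dot{x}_i=f(x_i,u_i)$, $y_i=h(x_i)$, where $x_i\in\mathcal{X}\subset\mathbb{R}^n$, $u_i\in\mathcal{U}\subset\mathbb{R}$, $y_i\in\mathcal{Y}\subset\mathbb{R}$, interconnected by $u=Py$ with $u=[u_1,\ldots,u_N]^T$, $y=[y_1,\ldots,y_N]^T$. The functions $f,h$ are continuously differentiable, and for each constant input $\bar u\in\mathcal{U}$ the cell system has a globally asymptotically stable steady state $S(\bar u)$. The maps $S:\mathcal{U}\to\mathcal{X}$ and $T:\mathcal{U}\to\mathcal{Y}$, $T(\cdot)=h(S(\cdot))$, are continuously differentiable, and $T$ is positive, bounded and decreasing. Linearized cells: for class $j$, $A_j=\frac{\partial f}{\partial x}(S(z_j),z_j)\in\mathbb{R}^{n\times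 n}$, $B_j=\frac{\partial f}{\partial u}(S(z_j),z_j)\in\mathbb{R}^{n\times 1}$, $C_j=\frac{\partial h}{\partial x}(S(z_j))\in\mathbb{R}^{1\times n}$. The linearized cell system is $\dot{\xi}=A_j\xi+B_jv$, $\eta=C_j\xi$ (input $v$, output $\eta$). Its $\mathcal{L}_2$-gain is the smallest $\gamma\ge 0$ with $\|\eta\|_{\mathcal{L}_2}\le\gamma\|v\|_{\mathcal{L}_2}$ for all $v\in\mathcal{L}_2[0,\infty)$ when $\xi(0)=0$. *)

theory Defs
  imports "HOL-Analysis.Analysis"
begin

section \<open>Contact graph and equitable partitions\<close>

text \<open>The vertex set is the (arbitrary) finite nonempty type \<^typ>\<open>'v\<close>.\<close>

definition degree :: "real^'v^'v \<Rightarrow> 'v::finite \<Rightarrow> real" where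
  "degree w i = (\<Sum>j\<in>UNIV. w $ i $ j)"

definition contact_graph :: "('v::finite \<times> 'v) set \<Rightarrow> real^'v^'v \<Rightarrow> bool" where
  "contact_graph E w \<longleftrightarrow>
     sym E \<and> E\<^sup>* = UNIV \<and>
     (\<forall>i j. w $ i $ j = w $ j $ i) \<and>
     (\<forall>i j. w $ i $ j \<ge> 0) \<and>
     (\<forall>i j. w $ i $ j = 0 \<longleftrightarrow> (i, j) \<notin> E) \<and>
     (\<forall>i. degree w i > 0)"

definition scaled_adjacency :: "real^'v^'v \<Rightarrow> real^'v^'v::finite" where
  "scaled_adjacency w = (\<chi> i j. w $ i $ j / degree w i)"

definition vertex_partition :: "('r::finite \<Rightarrow> 'v set) \<Rightarrow> bool" where
  "vertex_partition Q \<longleftrightarrow> (\<forall>j. Q j \<noteq> {}) \<and> disjoint_family Q \<and> (\<Union>j. Q j) = UNIV"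

text \<open>The partition \<open>Q\<close> is equitable with quotient matrix \<open>R\<close>; as the classes are nonempty,
  \<open>R\<close> is determined by \<open>P\<close> and \<open>Q\<close>.\<close>

definition equitable_with_quotient ::
    "real^'v^'v \<Rightarrow> ('r::finite \<Rightarrow> 'v::finite set) \<Rightarrow> real^'r^'r \<Rightarrow> bool" where
  "equitable_with_quotient P Q R \<longleftrightarrow>
     vertex_partition Q \<and> (\<forall>i j. \<forall>u\<in>Q i. (\<Sum>v\<in>Q j. P $ u $ v) = R $ i $ j)"

definition class_of :: "('r \<Rightarrow> 'v set) \<Rightarrow> 'v \<Rightarrow> 'r" where
  "class_of Q k = (THE j. k \<in> Q j)"


section \<open>Eigenvalues of real matrices\<close>

definition spectrum :: "real^'n^'n \<Rightarrow> complex set" where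
  "spectrum A = {\<mu>. \<exists>x. x \<noteq> 0 \<and> map_matrix complex_of_real A *v x = \<mu> *s x}"

definition spectral_radius :: "real^'n^'n \<Rightarrow> real" where
  "spectral_radius A = (SUP \<mu>\<in>spectrum A. cmod \<mu>)"

definition hurwitz :: "real^'n^'n \<Rightarrow> bool" where
  "hurwitz A \<longleftrightarrow> (\<forall>\<mu>\<in>spectrum A. Re \<mu> < 0)"


section \<open>Solutions and stability of autonomous systems\<close>

definition solution_on ::
    "('a::real_normed_vector \<Rightarrow> 'a) \<Rightarrow> 'a set \<Rightarrow> real set \<Rightarrow> (real \<Rightarrow> 'a) \<Rightarrow> bool" where
  "solution_on F D I x \<longleftrightarrow>
     (\<forall>t\<in>I. x t \<in> D \<and> (x has_vector_derivative F (x t)) (at t within I))"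

text \<open>Stability in the sense of Lyapunov, relative to the state space \<open>D\<close>. It is required of
  solutions on all compact intervals, so that solutions that are not global are covered as well.\<close>

definition stable_equilibrium ::
    "('a::real_normed_vector \<Rightarrow> 'a) \<Rightarrow> 'a set \<Rightarrow> 'a \<Rightarrow> bool" where
  "stable_equilibrium F D p \<longleftrightarrow>
     p \<in> D \<and> F p = 0 \<and>
     (\<forall>\<epsilon>>0. \<exists>\<delta>>0. \<forall>x \<tau>. solution_on F D {0..\<tau>} x \<longrightarrow> dist (x 0) p < \<delta> \<longrightarrow>
        (\<forall>t\<in>{0..\<tau>}. dist (x t) p < \<epsilon>))"

definition attracts ::
    "('a::real_normed_vector \<Rightarrow> 'a) \<Rightarrow> 'a set \<Rightarrow> 'a \<Rightarrow> 'a set \<Rightarrow> bool" where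
  "attracts F D p M \<longleftrightarrow>
     (\<forall>q\<in>M. (\<exists>x. solution_on F D {0..} x \<and> x 0 = q) \<and>
             (\<forall>x. solution_on F D {0..} x \<and> x 0 = q \<longrightarrow> (x \<longlongrightarrow> p) at_top))"

definition globally_asymptotically_stable ::
    "('a::real_normed_vector \<Rightarrow> 'a) \<Rightarrow> 'a set \<Rightarrow> 'a \<Rightarrow> bool" where
  "globally_asymptotically_stable F D p \<longleftrightarrow> stable_equilibrium F D p \<and> attracts F D p D"

definition locally_asymptotically_stable ::
    "('a::real_normed_vector \<Rightarrow> 'a) \<Rightarrow> 'a set \<Rightarrow> 'a \<Rightarrow> bool" where
  "locally_asymptotically_stable F D p \<longleftrightarrow>
     stable_equilibrium F D p \<and> (\<exists>\<delta>>0. attracts F D p (D \<inter> ball p \<delta>))"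


section \<open>Cells and the network\<close>

text \<open>Continuous differentiability on a set \<open>D\<close> that need not be open (such as an orthant) is
  read as continuous differentiability on some open set containing \<open>D\<close>, so that the partial
  derivatives at points of \<open>D\<close> are meaningful.\<close>

definition cont_differentiable_on ::
    "('a::real_normed_vector \<Rightarrow> 'b::real_normed_vector) \<Rightarrow> 'a set \<Rightarrow> bool" where
  "cont_differentiable_on g D \<longleftrightarrow>
     (\<exists>W g'. open W \<and> D \<subseteq> W \<and> continuous_on W g' \<and>
        (\<forall>x\<in>W. (g has_derivative blinfun_apply (g' x)) (at x)))"

definition cell_system ::
    "(real^'n \<Rightarrow> real \<Rightarrow> real^'n) \<Rightarrow> (real^'n \<Rightarrow> real) \<Rightarrow>
     (real^'n) set \<Rightarrow> real set \<Rightarrow> real set \<Rightarrow> (real \<Rightarrow> real^'n) \<Rightarrow> (real \<Rightarrow> real) \<Rightarrow> bool" where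
  "cell_system f h X U Y S T \<longleftrightarrow>
     (\<forall>x\<in>X. h x \<in> Y) \<and>
     cont_differentiable_on (\<lambda>(x, u). f x u) (X \<times> U) \<and>
     cont_differentiable_on h X \<and>
     (\<forall>u\<in>U. globally_asymptotically_stable (\<lambda>x. f x u) X (S u)) \<and>
     (\<forall>u\<in>U. T u = h (S u)) \<and>
     cont_differentiable_on S U \<and>
     cont_differentiable_on T U \<and>
     (\<forall>u\<in>U. T u > 0) \<and> bounded (T ` U) \<and> antimono_on U T"

definition network_input ::
    "(real^'n \<Rightarrow> real) \<Rightarrow> real^'v^'v \<Rightarrow> real^'n^'v \<Rightarrow> real^'v::finite" where
  "network_input h P x = P *v (\<chi> i. h (x $ i))"

text \<open>The field is defined on the whole space \<open>\<real>\<^sup>n\<^sup>N\<close>. It is continuously differentiable near the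
  states that lie in \<open>X\<close> cellwise, and local stability of such a state refers to all initial
  states near it; when \<open>X\<close> is open these are automatically states of the network. Stability and
  attraction for the solutions that remain in a smaller state space are then consequences.\<close>

definition network_field ::
    "(real^'n \<Rightarrow> real \<Rightarrow> real^'n) \<Rightarrow> (real^'n \<Rightarrow> real) \<Rightarrow> real^'v^'v \<Rightarrow> real^'n^'v \<Rightarrow> real^'n^'v::finite" where
  "network_field f h P x = (\<chi> i. f (x $ i) (network_input h P x $ i))"

definition network_states :: "(real^'n) set \<Rightarrow> (real^'n^'v) set" where
  "network_states X = {x. \<forall>i. x $ i \<in> X}"


section \<open>Linearized cells\<close>

text \<open>The input matrix (a column) and the output matrix (a row) are represented by vectors
  \<open>B\<close> and \<open>C\<close>, the output of the linear system being \<open>C \<bullet> \<xi>\<close>.\<close>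

definition lin_A :: "(real^'n \<Rightarrow> real \<Rightarrow> real^'n) \<Rightarrow> real^'n \<Rightarrow> real \<Rightarrow> real^'n^'n" where
  "lin_A f x u = jacobian (\<lambda>x'. f x' u) (at x)"

definition lin_B :: "(real^'n \<Rightarrow> real \<Rightarrow> real^'n) \<Rightarrow> real^'n \<Rightarrow> real \<Rightarrow> real^'n" where
  "lin_B f x u = vector_derivative (\<lambda>u'. f x u') (at u)"

definition lin_C :: "(real^'n \<Rightarrow> real) \<Rightarrow> real^'n \<Rightarrow> real^'n" where
  "lin_C h x = (\<chi> i. frechet_derivative h (at x) (axis i 1))"

definition observable :: "real^'n^'n \<Rightarrow> real^'n \<Rightarrow> bool" where
  "observable A C \<longleftrightarrow>
     (\<forall>\<xi> \<zeta>. solution_on (\<lambda>x. A *v x) UNIV {0..} \<xi> \<longrightarrow> solution_on (\<lambda>x. A *v x) UNIV {0..} \<zeta> \<longrightarrow>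
        (\<forall>t\<ge>0. C \<bullet> \<xi> t = C \<bullet> \<zeta> t) \<longrightarrow> \<xi> 0 = \<zeta> 0)"

definition in_L2 :: "(real \<Rightarrow> real) \<Rightarrow> bool" where
  "in_L2 v \<longleftrightarrow> set_borel_measurable lborel {0..} v \<and> set_integrable lborel {0..} (\<lambda>t. (v t)\<^sup>2)"

definition L2_norm :: "(real \<Rightarrow> real) \<Rightarrow> real" where
  "L2_norm v = sqrt (LINT t:{0..}|lborel. (v t)\<^sup>2)"

text \<open>As inputs in \<open>L2\<close> may be discontinuous, state trajectories are solutions in the sense of
  Caratheodory, i.e. of the integrated equation.\<close>

definition forced_trajectory ::
    "real^'n^'n \<Rightarrow> real^'n \<Rightarrow> (real \<Rightarrow> real) \<Rightarrow> (real \<Rightarrow> real^'n) \<Rightarrow> bool" where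
  "forced_trajectory A B v \<xi> \<longleftrightarrow>
     continuous_on {0..} \<xi> \<and>
     (\<forall>t\<ge>0. ((\<lambda>s. A *v \<xi> s + v s *\<^sub>R B) has_integral (\<xi> t - \<xi> 0)) {0..t})"

definition L2_gain_bound :: "real^'n^'n \<Rightarrow> real^'n \<Rightarrow> real^'n \<Rightarrow> real \<Rightarrow> bool" where
  "L2_gain_bound A B C \<gamma> \<longleftrightarrow>
     \<gamma> \<ge> 0 \<and>
     (\<forall>v \<xi>. in_L2 v \<longrightarrow> forced_trajectory A B v \<xi> \<longrightarrow> \<xi> 0 = 0 \<longrightarrow>
        in_L2 (\<lambda>t. C \<bullet> \<xi> t) \<and> L2_norm (\<lambda>t. C \<bullet> \<xi> t) \<le> \<gamma> * L2_norm v)"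

definition is_L2_gain :: "real^'n^'n \<Rightarrow> real^'n \<Rightarrow> real^'n \<Rightarrow> real \<Rightarrow> bool" where
  "is_L2_gain A B C \<gamma> \<longleftrightarrow>
     L2_gain_bound A B C \<gamma> \<and> (\<forall>\<gamma>'. L2_gain_bound A B C \<gamma>' \<longrightarrow> \<gamma> \<le> \<gamma>')"

definition gain_matrix :: "('r \<Rightarrow> 'v set) \<Rightarrow> ('r \<Rightarrow> real) \<Rightarrow> real^'v^'v::finite" where
  "gain_matrix Q \<gamma> = (\<chi> k l. if k = l then \<gamma> (class_of Q k) else 0)"

end

theory Submission
  imports Defs "HOL-Computational_Algebra.Fundamental_Theorem_Algebra"
begin

text \<open>The network linearized at the pattern has no eigenvalue \<open>\<mu>\<close> with \<open>Re \<mu> \<ge> 0\<close>: along an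
  eigenvector, let \<open>u\<close> be the vector of cell input amplitudes. Since the \<open>\<L>\<^sub>2\<close>-gain dominates the
  transfer function on the closed right half plane, the output amplitudes are at most \<open>\<Gamma> \<bar>u\<bar>\<close>, hence
  \<open>\<bar>u\<bar> \<le> P \<Gamma> \<bar>u\<bar>\<close> componentwise, and \<open>\<rho>(P \<Gamma>) < 1\<close> forces \<open>u = 0\<close>; then the eigenvector is a sum of
  eigenvectors of the Hurwitz matrices \<open>A\<^sub>j\<close>, a contradiction.

  A linear map without such eigenvalues is annihilated by a product of factors \<open>A - \<mu>\<^sub>k\<close> with
  \<open>Re \<mu>\<^sub>k < 0\<close>, and a weighted sum of the squared norms of the partial products applied to \<open>x\<close> is a
  quadratic Lyapunov function. It yields the nonlinear stability, the decay of the cell transients,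
  and (applied to \<open>P \<Gamma> - I\<close>) the bound on the spectral radius.\<close>

section \<open>Quadratic Lyapunov functions of linear maps\<close>

text \<open>Why a product of factors suffices: along \<open>x' = A x\<close> the partial products
  \<open>y_0 = x\<close>, \<open>y_(k+1) = (A - \<mu>) y_k\<close> (each with its own \<mu>) form a
  cascade \<open>y_k' = \<mu> y_k + y_(k+1)\<close> that ends in 0. Each member decays by itself and
  is driven only by its successor, so large enough weights on the later members absorb the coupling.
  Neither a Jordan basis nor a matrix exponential enters.

  The gain is a statement about square integrable inputs and the initial state 0, whereas an
  eigenvector with \<open>Re \<mu> \<ge> 0\<close> yields a nondecaying exponential with nonzero
  initial state. Truncation in time and comparison with the decaying free response bridge this gap.

  Attraction includes the existence of a solution on the whole half line from every nearby state.
  For this reason a local Lipschitz bound of the network field is carried along with its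
  derivative.\<close>

text \<open>The pair \<open>(x, y)\<close> stands for \<open>x + \<i> y\<close> in the complexification of a real vector space, so
  that complex eigenvalues make sense for linear maps on any Euclidean space.\<close>

definition cscale :: "complex \<Rightarrow> 'a \<times> 'a \<Rightarrow> 'a \<times> 'a::real_vector" where
  "cscale \<mu> v = (Re \<mu> *\<^sub>R fst v - Im \<mu> *\<^sub>R snd v, Im \<mu> *\<^sub>R fst v + Re \<mu> *\<^sub>R snd v)"

definition cmap :: "('a \<Rightarrow> 'b) \<Rightarrow> 'a \<times> 'a \<Rightarrow> 'b \<times> 'b" where
  "cmap A v = (A (fst v), A (snd v))"

definition complex_eigenvalue :: "('a::real_vector \<Rightarrow> 'a) \<Rightarrow> complex \<Rightarrow> bool" where
  "complex_eigenvalue A \<mu> \<longleftrightarrow> (\<exists>v. v \<noteq> 0 \<and> cmap A v = cscale \<mu> v)"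

definition shift :: "('a::real_vector \<Rightarrow> 'a) \<Rightarrow> complex \<Rightarrow> 'a \<times> 'a \<Rightarrow> 'a \<times> 'a" where
  "shift A \<mu> v = cmap A v - cscale \<mu> v"

lemma cscale_add: "cscale \<mu> (v + w) = cscale \<mu> v + cscale \<mu> w"
  by (simp add: cscale_def prod_eq_iff algebra_simps)

lemma cscale_add_left: "cscale (\<mu> + \<nu>) v = cscale \<mu> v + cscale \<nu> v"
  by (simp add: cscale_def prod_eq_iff algebra_simps)

lemma cscale_cscale: "cscale \<mu> (cscale \<nu> v) = cscale (\<mu> * \<nu>) v"
  by (simp add: cscale_def prod_eq_iff algebra_simps)

lemma cscale_zero [simp]: "cscale 0 v = 0" "cscale \<mu> 0 = 0"
  by (simp_all add: cscale_def prod_eq_iff)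

lemma cscale_one [simp]: "cscale 1 v = v"
  by (simp add: cscale_def prod_eq_iff)

lemma cscale_minus: "cscale (- \<mu>) v = - cscale \<mu> v"
  by (simp add: cscale_def prod_eq_iff)

lemma cscale_of_real: "cscale (complex_of_real c) v = c *\<^sub>R v"
  by (simp add: cscale_def prod_eq_iff)

lemma cscale_eq_0_iff: "cscale \<mu> v = 0 \<longleftrightarrow> \<mu> = 0 \<or> v = 0"
  by (metis cscale_cscale cscale_one cscale_zero left_inverse)

lemma linear_cscale: "linear (cscale \<mu>)"
  by (rule linearI) (simp_all add: cscale_def prod_eq_iff algebra_simps)

lemma linear_cmap: "linear A \<Longrightarrow> linear (cmap A)"
  by (rule linearI) (simp_all add: cmap_def prod_eq_iff linear_add linear_scale)

lemma cmap_cscale: "linear A \<Longrightarrow> cmap A (cscale \<mu> v) = cscale \<mu> (cmap A v)"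
  by (simp add: cmap_def cscale_def linear_add linear_diff linear_scale)

lemma linear_shift: "linear A \<Longrightarrow> linear (shift A \<mu>)"
  unfolding shift_def by (intro linear_compose_sub linear_cmap linear_cscale)

lemma shift_cmap: "linear A \<Longrightarrow> shift A \<mu> (cmap A v) = cmap A (shift A \<mu> v)"
  by (simp add: shift_def cmap_cscale linear_diff[OF linear_cmap])

lemma shift_commute: "linear A \<Longrightarrow> shift A \<mu> (shift A \<nu> v) = shift A \<nu> (shift A \<mu> v)"
  by (simp add: shift_def cmap_cscale linear_diff[OF linear_cmap] linear_diff[OF linear_cscale]
      cscale_cscale mult.commute)

lemma foldr_shift_commute:
  "linear A \<Longrightarrow> foldr (shift A) \<mu>s (shift A \<mu> v) = shift A \<mu> (foldr (shift A) \<mu>s v)"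
  by (induction \<mu>s) (simp_all add: shift_commute)

lemma foldr_shift_cmap:
  "linear A \<Longrightarrow> foldr (shift A) \<mu>s (cmap A v) = cmap A (foldr (shift A) \<mu>s v)"
  by (induction \<mu>s) (simp_all add: shift_cmap)

lemma foldr_shift_foldr_shift:
  "linear A \<Longrightarrow>
    foldr (shift A) \<mu>s (foldr (shift A) \<nu>s v) = foldr (shift A) \<nu>s (foldr (shift A) \<mu>s v)"
  by (induction \<nu>s) (simp_all add: foldr_shift_commute)

lemma linear_foldr_shift: "linear A \<Longrightarrow> linear (foldr (shift A) \<mu>s)"
proof (induction \<mu>s)
  case Nil
  have "foldr (shift A) [] = (\<lambda>v. v)" by (simp add: fun_eq_iff)
  then show ?case by (simp only: linear_ident)
next
  case (Cons \<mu> \<mu>s)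
  then show ?case using linear_compose[of "foldr (shift A) \<mu>s" "shift A \<mu>"] by (simp add: linear_shift o_def)
qed

section \<open>Polynomials in a linear map and annihilating products of factors\<close>

text \<open>This is p(A) with complex coefficients on the complexification. The powers of
  \<open>A\<close> act on the argument rather than on the result, so the recursion and additivity in
  \<open>p\<close> hold without linearity of \<open>A\<close>.\<close>

definition poly_map :: "('a::real_vector \<Rightarrow> 'a) \<Rightarrow> complex poly \<Rightarrow> 'a \<times> 'a \<Rightarrow> 'a \<times> 'a" where
  "poly_map A p = fold_coeffs (\<lambda>a g v. cscale a v + g (cmap A v)) p (\<lambda>_. 0)"

lemma poly_map_0 [simp]: "poly_map A 0 v = 0"
  by (simp add: poly_map_def)

lemma poly_map_pCons: "poly_map A (pCons a p) v = cscale a v + poly_map A p (cmap A v)"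
  \<comment> \<open>\<open>pCons 0 0\<close> is the zero polynomial, whose coefficient list is
    empty; only there does the fold not unroll.\<close>
  by (cases "a = 0 \<and> p = 0") (auto simp: poly_map_def)

lemma poly_map_add: "poly_map A (p + q) v = poly_map A p v + poly_map A q v"
  by (induction p q arbitrary: v rule: poly_induct2)
     (simp_all add: poly_map_pCons cscale_add_left algebra_simps)

lemma poly_map_smult: "linear A \<Longrightarrow> poly_map A (smult c p) v = poly_map A p (cscale c v)"
  by (induction p arbitrary: v)
     (simp_all add: poly_map_pCons cscale_cscale cmap_cscale mult.commute)

lemma poly_map_add_right:
  "linear A \<Longrightarrow> poly_map A p (v + w) = poly_map A p v + poly_map A p w"
  by (induction p arbitrary: v w)
     (simp_all add: poly_map_pCons cscale_add linear_add[OF linear_cmap])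

lemma poly_map_root_factor:
  "linear A \<Longrightarrow> poly_map A ([:-\<mu>, 1:] * q) v = poly_map A q (shift A \<mu> v)"
proof -
  assume A: "linear A"
  have "poly_map A ([:-\<mu>, 1:] * q) v = poly_map A q (cscale (-\<mu>) v) + poly_map A q (cmap A v)"
    using poly_map_add[of A "smult (-\<mu>) q" "pCons 0 q" v]
    by (simp add: poly_map_smult[OF A] poly_map_pCons flip: smult_minus_left)
  also have "\<dots> = poly_map A q (shift A \<mu> v)"
    by (simp add: shift_def cscale_minus flip: poly_map_add_right[OF A])
  finally show ?thesis .
qed

lemma poly_map_monom: "poly_map A (monom c i) v = cscale c ((cmap A ^^ i) v)"
  by (induction i arbitrary: v)
     (simp_all add: monom_0 monom_Suc poly_map_pCons funpow_swap1)

lemma poly_map_sum: "poly_map A (sum p I) v = (\<Sum>i\<in>I. poly_map A (p i) v)"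
  by (induction I rule: infinite_finite_induct) (simp_all add: poly_map_add)

text \<open>The vectors \<open>b, A b, ..., A^n b\<close> are one too many for dimension n. As
  linear dependence concerns sets, a repetition among them is treated apart: there
  \<open>X^i - X^j\<close> annihilates \<open>b\<close>.\<close>

lemma annihilating_poly_exists:
  fixes A :: "'a::euclidean_space \<Rightarrow> 'a"
  assumes "linear A"
  shows "\<exists>p. p \<noteq> 0 \<and> poly_map A p (b, 0) = 0"
proof -
  define a where "a i = (A ^^ i) b" for i
  have pw: "(cmap A ^^ i) (b, 0) = (a i, 0)" for i
    by (induction i) (simp_all add: a_def cmap_def linear_0[OF assms])
  define n where "n = DIM('a)"
  show ?thesis
  proof (cases "inj_on a {..n}")
    case True
    then have "card (a ` {..n}) = Suc n" by (simp add: card_image)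
    then have "dependent (a ` {..n})"
      using independent_bound[of "a ` {..n}"] by (auto simp: n_def)
    then obtain u where u: "\<exists>x\<in>a ` {..n}. u x \<noteq> 0" "(\<Sum>x\<in>a ` {..n}. u x *\<^sub>R x) = 0"
      by (auto simp: dependent_finite)
    then obtain k where k: "k \<le> n" "u (a k) \<noteq> 0" by auto
    have s: "(\<Sum>i\<le>n. u (a i) *\<^sub>R a i) = 0"
      using u(2) by (simp add: sum.reindex[OF True])
    define p where "p = (\<Sum>i\<le>n. monom (complex_of_real (u (a i))) i)"
    have "coeff p k = complex_of_real (u (a k))"
      using k by (simp add: p_def coeff_sum)
    then have "p \<noteq> 0" using k by auto
    moreover have "poly_map A p (b, 0) = (\<Sum>i\<le>n. (u (a i) *\<^sub>R a i, 0))"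
      by (simp add: p_def poly_map_sum poly_map_monom pw cscale_of_real)
    then have "poly_map A p (b, 0) = 0"
      using s by (simp add: sum_prod prod_eq_iff fst_sum snd_sum)
    ultimately show ?thesis by blast
  next
    case False
    then obtain i j where ij: "a i = a j" "i \<noteq> j" by (auto simp: inj_on_def)
    define p :: "complex poly" where "p = monom 1 i + monom (-1) j"
    have "coeff p i = 1" using ij by (simp add: p_def)
    then have "p \<noteq> 0" by auto
    moreover have "poly_map A p (b, 0) = 0"
      using ij by (simp add: p_def poly_map_add poly_map_monom pw cscale_minus prod_eq_iff)
    ultimately show ?thesis by blast
  qed
qed

text \<open>The roots of \<open>p\<close> are split off one by one, each factor being absorbed into
  \<open>v\<close>, which is why the induction generalizes over \<open>v\<close>. A root that is not
  an eigenvalue gives an injective factor, which can be cancelled.\<close>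

lemma annihilating_eigenvalues_of_poly:
  assumes "linear A" "p \<noteq> 0" "poly_map A p v = 0"
  shows "\<exists>\<mu>s. (\<forall>\<mu>\<in>set \<mu>s. complex_eigenvalue A \<mu>) \<and> foldr (shift A) \<mu>s v = 0"
  using assms(2,3)
proof (induction "Polynomial.degree p" arbitrary: p v)
  case 0
  then obtain c where "p = [:c:]" "c \<noteq> 0" by (metis degree_eq_zeroE pCons_0_0)
  then have "v = 0" using 0 by (simp add: poly_map_pCons cscale_eq_0_iff)
  then show ?case by (intro exI[of _ "[]"]) simp
next
  case (Suc n)
  then have "\<not> constant (poly p)" by (simp add: constant_degree)
  then obtain \<mu> where "poly p \<mu> = 0" using fundamental_theorem_of_algebra by blast
  then obtain q where q: "p = [:-\<mu>, 1:] * q" by (metis poly_eq_0_iff_dvd dvdE)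
  with Suc have "q \<noteq> 0" by auto
  then have "Polynomial.degree p = Suc (Polynomial.degree q)" unfolding q by (subst degree_mult_eq) auto
  moreover have "poly_map A q (shift A \<mu> v) = 0"
    using Suc.prems(2) poly_map_root_factor[OF assms(1)] unfolding q by metis
  moreover from calculation have "n = Polynomial.degree q" using Suc.hyps(2) by simp
  ultimately obtain \<mu>s where \<mu>s: "\<forall>\<mu>\<in>set \<mu>s. complex_eigenvalue A \<mu>"
      "foldr (shift A) \<mu>s (shift A \<mu> v) = 0"
    using Suc.hyps(1)[of q "shift A \<mu> v"] \<open>q \<noteq> 0\<close> by blast
  then have z: "shift A \<mu> (foldr (shift A) \<mu>s v) = 0"
    by (simp add: foldr_shift_commute assms(1))
  show ?case
  proof (cases "complex_eigenvalue A \<mu>")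
    case True
    then show ?thesis using z \<mu>s by (intro exI[of _ "\<mu> # \<mu>s"]) auto
  next
    case False
    then have "foldr (shift A) \<mu>s v = 0"
      using z by (metis complex_eigenvalue_def shift_def right_minus_eq)
    then show ?thesis using \<mu>s by blast
  qed
qed

text \<open>The lists that annihilate the single basis vectors are concatenated. The factors
  commute, so each list can be moved next to the vector that it annihilates.\<close>

lemma annihilating_eigenvalues_exist:
  fixes A :: "'a::euclidean_space \<Rightarrow> 'a"
  assumes "linear A"
  shows "\<exists>\<mu>s. (\<forall>\<mu>\<in>set \<mu>s. complex_eigenvalue A \<mu>) \<and> (\<forall>x. foldr (shift A) \<mu>s (x, 0) = 0)"
proof -
  have "\<exists>\<mu>s. (\<forall>\<mu>\<in>set \<mu>s. complex_eigenvalue A \<mu>) \<and> (\<forall>b\<in>S. foldr (shift A) \<mu>s (b, 0) = 0)"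
    if "finite S" for S :: "'a set"
    using that
  proof (induction S)
    case empty
    show ?case by (intro exI[of _ "[]"]) simp
  next
    case (insert b S)
    then obtain \<mu>s where \<mu>s: "\<forall>\<mu>\<in>set \<mu>s. complex_eigenvalue A \<mu>"
      "\<forall>b\<in>S. foldr (shift A) \<mu>s (b, 0) = 0" by blast
    obtain p where "p \<noteq> 0" "poly_map A p (b, 0) = 0"
      using annihilating_poly_exists[OF assms] by blast
    then obtain \<nu>s where \<nu>s: "\<forall>\<mu>\<in>set \<nu>s. complex_eigenvalue A \<mu>"
      "foldr (shift A) \<nu>s (b, 0) = 0"
      using annihilating_eigenvalues_of_poly[OF assms] by blast
    have "foldr (shift A) (\<mu>s @ \<nu>s) (c, 0) = 0" if "c \<in> insert b S" for c
      using that
    proof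
      assume "c = b"
      then show ?thesis using \<nu>s(2) linear_0[OF linear_foldr_shift[OF assms]] by simp
    next
      assume "c \<in> S"
      then have "foldr (shift A) \<mu>s (c, 0) = 0" using \<mu>s(2) by blast
      then show ?thesis
        using foldr_shift_foldr_shift[OF assms, of \<mu>s \<nu>s "(c, 0)"]
          linear_0[OF linear_foldr_shift[OF assms]] by simp
    qed
    then show ?case using \<mu>s(1) \<nu>s(1) by (intro exI[of _ "\<mu>s @ \<nu>s"]) auto
  qed
  then obtain \<mu>s where \<mu>s: "\<forall>\<mu>\<in>set \<mu>s. complex_eigenvalue A \<mu>"
      "\<forall>b\<in>Basis. foldr (shift A) \<mu>s (b :: 'a, 0) = 0"
    using finite_Basis by blast
  have lin: "linear (\<lambda>x::'a. foldr (shift A) \<mu>s (x, 0))"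
    by (intro linear_compose[OF _ linear_foldr_shift[OF assms], unfolded o_def] linearI)
       (simp_all add: prod_eq_iff)
  have "(\<lambda>x::'a. foldr (shift A) \<mu>s (x, 0)) = (\<lambda>_. 0)"
    using \<mu>s(2) by (intro linear_eq_stdbasis[OF lin]) (auto simp: linear_zero)
  then show ?thesis using \<mu>s(1) by (auto dest: fun_cong)
qed

section \<open>The quadratic form built from the factors\<close>

text \<open>The part of the scaling by \<open>Im \<mu>\<close> is a multiple of a quarter turn,
  hence skew, and drops out.\<close>

lemma inner_cscale_self: "inner v (cscale \<mu> v) = Re \<mu> * (inner v v)"
  for v :: "'a::real_inner \<times> 'a"
  by (cases v) (simp add: cscale_def inner_prod_def inner_diff_right inner_add_right
      inner_commute algebra_simps)


lemma bounded_bilinear_inner_linear: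
  fixes L :: "'a::euclidean_space \<Rightarrow> 'b::euclidean_space"
  assumes "linear L"
  shows "bounded_bilinear (\<lambda>x y. inner (L x) (L y))"
  using assms linear_conv_bounded_linear bounded_bilinear.comp[OF bounded_bilinear_inner] by blast

lemma bounded_bilinear_add_scale:
  fixes B :: "'a::euclidean_space \<Rightarrow> 'a \<Rightarrow> real"
  assumes "bounded_bilinear B" "bounded_bilinear D"
  shows "bounded_bilinear (\<lambda>x y. B x y + c * D x y)"
  using assms
  by (simp add: bilinear_conv_bounded_bilinear[symmetric] bilinear_def linear_compose_add
      linear_compose_scale_right[where 'b=real, simplified])

text \<open>With \<open>y = (A - \<mu>) v\<close> the left side is
  \<open>Re \<mu> * (norm v)^2\<close> plus the inner product of \<open>v\<close> and
  \<open>y\<close>. Young's inequality, weighted by \<open>- Re \<mu>\<close>, spends half of the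
  decay on this cross term.\<close>

lemma inner_shift_le:
  fixes v :: "'a::euclidean_space \<times> 'a"
  assumes "Re \<mu> < 0"
  shows "inner v (cmap A v) \<le> Re \<mu> / 2 * (norm v)\<^sup>2 + 1 / (2 * - Re \<mu>) * (norm (shift A \<mu> v))\<^sup>2"
proof -
  define r y where "r = - Re \<mu>" and "y = shift A \<mu> v"
  have r: "r > 0" using assms by (simp add: r_def)
  have "cmap A v = cscale \<mu> v + y" by (simp add: y_def shift_def)
  then have *: "inner v (cmap A v) = - r * (norm v)\<^sup>2 + inner v y"
    by (simp add: inner_add_right inner_cscale_self r_def power2_norm_eq_inner)
  have "0 \<le> (norm (r *\<^sub>R v - y))\<^sup>2" by simp
  also have "\<dots> = r\<^sup>2 * (norm v)\<^sup>2 + (norm y)\<^sup>2 - 2 * r * inner v y"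
    unfolding power2_norm_eq_inner
    by (simp add: inner_diff_left inner_diff_right inner_commute[of y v] algebra_simps power2_eq_square)
  finally have "inner v y \<le> (r\<^sup>2 * (norm v)\<^sup>2 + (norm y)\<^sup>2) / (2 * r)"
    using r by (subst pos_le_divide_eq) (simp_all add: mult_ac)
  also have "\<dots> = r / 2 * (norm v)\<^sup>2 + 1 / (2 * r) * (norm y)\<^sup>2"
    using r by (simp add: add_divide_distrib power2_eq_square)
  finally have "inner v (cmap A v) \<le> - r / 2 * (norm v)\<^sup>2 + 1 / (2 * r) * (norm y)\<^sup>2"
    using * by linarith
  then show ?thesis by (simp add: r_def y_def)
qed

definition symmetric_form :: "('a \<Rightarrow> 'a \<Rightarrow> real) \<Rightarrow> bool" where
  "symmetric_form B \<longleftrightarrow> (\<forall>x y. B x y = B y x)"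

text \<open>The norm of the full product is a residual that the form does not yet control. A further
  factor adds a multiple of the old residual to the form, and the new residual is the old product
  with one more factor applied.\<close>

lemma quadratic_form_of_eigenvalue_list:
  fixes A :: "'a::euclidean_space \<Rightarrow> 'a"
  assumes "linear A" "\<forall>\<mu>\<in>set \<mu>s. Re \<mu> < 0"
  shows "\<exists>B a K. a > 0 \<and> K \<ge> 0 \<and> bounded_bilinear B \<and> symmetric_form B \<and>
      (\<forall>v. B v v \<ge> 0 \<and> (norm v)\<^sup>2 \<le> B v v + (norm (foldr (shift A) \<mu>s v))\<^sup>2 \<and>
        B v (cmap A v) \<le> - a * B v v + K * (norm (foldr (shift A) \<mu>s v))\<^sup>2)"
  using assms(2)
proof (induction \<mu>s)
  \<comment> \<open>Without factors the residual is the vector itself, so the zero form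
    works.\<close>
  case Nil
  have "bounded_bilinear (\<lambda>_ _. 0 :: real)"
    by (rule bounded_bilinear.intro) (auto intro: exI[of _ 0])
  then show ?case
    by (intro exI[of _ "\<lambda>_ _. 0"] exI[of _ "1 :: real"]) (simp add: symmetric_form_def)
next
  case (Cons \<mu> \<mu>s)
  define Y where "Y = foldr (shift A) \<mu>s"
  obtain B a K where B: "a > 0" "K \<ge> 0" "bounded_bilinear B" "symmetric_form B"
    "\<And>v. B v v \<ge> 0" "\<And>v. (norm v)\<^sup>2 \<le> B v v + (norm (Y v))\<^sup>2"
    "\<And>v. B v (cmap A v) \<le> - a * B v v + K * (norm (Y v))\<^sup>2"
    using Cons unfolding Y_def by auto
  define r where "r = - Re \<mu>"
  have r: "r > 0" using Cons.prems by (simp add: r_def)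
  \<comment> \<open>\<open>C \<ge> 1\<close> pays for the old residual in the lower bound. Of the
    decay \<open>C * r / 2\<close> of the new term, one half covers the old error \<open>K\<close>,
    since \<open>K \<le> C * r / 4\<close>; the other half is left as decay.\<close>
  define C where "C = max 1 (4 * K / r)"
  have C: "C \<ge> 1" "K \<le> C * r / 4"
    using r by (auto simp: C_def field_simps max_def)
  define B' where "B' x y = B x y + C * inner (Y x) (Y y)" for x y
  \<comment> \<open>The old form decays at rate \<open>a\<close>, the new term at the remaining rate
    \<open>r / 4\<close>.\<close>
  define a' where "a' = min a (r / 4)"
  have linY: "linear Y" unfolding Y_def by (rule linear_foldr_shift[OF assms(1)])
  have bil: "bounded_bilinear B'"
    unfolding B'_def
    by (intro bounded_bilinear_add_scale B(3) bounded_bilinear_inner_linear linY)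
  have nonneg: "B' v v \<ge> 0" for v
    using C B(5)[of v] by (simp add: B'_def)
  have lower: "(norm v)\<^sup>2 \<le> B' v v + (norm (shift A \<mu> (Y v)))\<^sup>2" for v
  proof -
    have "1 * (norm (Y v))\<^sup>2 \<le> C * (norm (Y v))\<^sup>2" by (intro mult_right_mono C) simp
    then show ?thesis
      using B(6)[of v] by (simp add: B'_def power2_norm_eq_inner[symmetric] add_increasing2)
  qed
  have decrease: "B' v (cmap A v) \<le> - a' * B' v v + C / (2 * r) * (norm (shift A \<mu> (Y v)))\<^sup>2" for v
  proof -
    have "inner (Y v) (Y (cmap A v)) \<le>
        - r / 2 * (norm (Y v))\<^sup>2 + 1 / (2 * r) * (norm (shift A \<mu> (Y v)))\<^sup>2"
      using inner_shift_le[of \<mu> "Y v" A] r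
      by (simp add: Y_def foldr_shift_cmap[OF assms(1)] r_def)
    then have "C * inner (Y v) (Y (cmap A v)) \<le>
        C * (- r / 2 * (norm (Y v))\<^sup>2 + 1 / (2 * r) * (norm (shift A \<mu> (Y v)))\<^sup>2)"
      using C by (intro mult_left_mono) auto
    moreover have "K * (norm (Y v))\<^sup>2 \<le> C * r / 4 * (norm (Y v))\<^sup>2"
      by (intro mult_right_mono C) simp
    moreover have "a' * B v v \<le> a * B v v" "a' * (C * (norm (Y v))\<^sup>2) \<le> r / 4 * (C * (norm (Y v))\<^sup>2)"
      using B(5)[of v] C by (auto simp: a'_def simp del: times_divide_eq_left intro!: mult_right_mono)
    ultimately show ?thesis
      using B(7)[of v] by (simp add: B'_def power2_norm_eq_inner[symmetric] algebra_simps)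
  qed
  have Y': "foldr (shift A) (\<mu> # \<mu>s) v = shift A \<mu> (Y v)" for v
    by (simp add: Y_def)
  have pos: "a' > 0" "C / (2 * r) \<ge> 0" using B(1) r C by (auto simp: a'_def)
  have sym: "symmetric_form B'"
    using B(4) by (simp add: B'_def symmetric_form_def inner_commute)
  show ?case
    unfolding Y'
    by (rule exI[of _ B'], rule exI[of _ a'], rule exI[of _ "C / (2 * r)"])
       (intro conjI allI pos sym nonneg bil lower decrease)
qed

text \<open>With the annihilating list the residual vanishes on the pairs \<open>(x, 0)\<close>,
  which \<open>cmap A\<close> preserves. The form is therefore restricted to these.\<close>

lemma quadratic_lyapunov_function:
  fixes A :: "'a::euclidean_space \<Rightarrow> 'a"
  assumes "linear A" "\<And>\<mu>. complex_eigenvalue A \<mu> \<Longrightarrow> Re \<mu> < 0"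
  shows "\<exists>B a. a > 0 \<and> bounded_bilinear B \<and> symmetric_form B \<and>
    (\<forall>x. (norm x)\<^sup>2 \<le> B x x) \<and> (\<forall>x. B x (A x) \<le> - a * B x x)"
proof -
  obtain \<mu>s where \<mu>s: "\<forall>\<mu>\<in>set \<mu>s. complex_eigenvalue A \<mu>" "\<forall>x. foldr (shift A) \<mu>s (x, 0) = 0"
    using annihilating_eigenvalues_exist[OF assms(1)] by blast
  then have "\<forall>\<mu>\<in>set \<mu>s. Re \<mu> < 0" using assms(2) by blast
  from quadratic_form_of_eigenvalue_list[OF assms(1) this]
  obtain B a K where B: "a > 0" "bounded_bilinear B" "symmetric_form B"
    "\<And>v. (norm v)\<^sup>2 \<le> B v v + (norm (foldr (shift A) \<mu>s v))\<^sup>2"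
    "\<And>v. B v (cmap A v) \<le> - a * B v v + K * (norm (foldr (shift A) \<mu>s v))\<^sup>2"
    by blast
  define D where "D x y = B (x, 0) (y, 0)" for x y :: 'a
  have e: "bounded_linear (\<lambda>x::'a. (x, 0::'a))"
    by (intro bounded_linear_Pair bounded_linear_ident bounded_linear_zero)
  have "bounded_bilinear D" unfolding D_def by (rule bounded_bilinear.comp[OF B(2) e e])
  moreover have "symmetric_form D" using B(3) by (simp add: D_def symmetric_form_def)
  moreover have "(norm x)\<^sup>2 \<le> D x x" for x
    using B(4)[of "(x, 0)"] \<mu>s(2) by (simp add: D_def norm_Pair)
  moreover have "D x (A x) \<le> - a * D x x" for x
    using B(5)[of "(x, 0)"] \<mu>s(2) by (simp add: D_def cmap_def linear_0[OF assms(1)])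
  ultimately show ?thesis using B(1) by blast
qed

section \<open>Stability from a quadratic Lyapunov function\<close>

lemma integral_has_vector_derivative_atLeast:
  fixes g :: "real \<Rightarrow> 'a::banach"
  assumes "continuous_on {a..} g" "t \<ge> a"
  shows "((\<lambda>s. integral {a..s} g) has_vector_derivative g t) (at t within {a..})"
proof -
  have "((\<lambda>s. integral {a..s} g) has_vector_derivative g t) (at t within {a..t+1})"
    using assms by (intro integral_has_vector_derivative continuous_on_subset[OF assms(1)]) auto
  moreover have "at t within {a..t+1} = at t within {a..}"
    by (rule at_within_nhd[of _ "{..<t+1}"]) auto
  ultimately show ?thesis by simp
qed

text \<open>Picard iteration in a weighted sup norm: a solution is sought as
  \<open>exp (c * t)\<close> times a bounded continuous function. For large \<open>c\<close> the
  iteration contracts on the whole half line at once, so no local solutions have to be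
  glued.\<close>

lemma lipschitz_solution_exists:
  fixes G :: "'a::euclidean_space \<Rightarrow> 'a"
  assumes lip: "L-lipschitz_on UNIV G"
  shows "\<exists>x. solution_on G UNIV {0..} x \<and> x 0 = q"
proof -
  have L: "L \<ge> 0" using lip by (rule lipschitz_on_nonneg)
  \<comment> \<open>The contraction constant will be \<open>L / c\<close>; the summand 1 keeps
    \<open>c\<close> positive when \<open>L = 0\<close>.\<close>
  define c where "c = 2 * L + 1"
  have c: "c > 0" "L / c \<le> 1 / 2" using L by (auto simp: c_def field_simps)
  have exp_int: "((\<lambda>s. exp (c * s)) has_integral (exp (c * t) - 1) / c) {0..t}" if "t \<ge> 0" for t
  proof -
    have "((\<lambda>s. exp (c * s)) has_integral exp (c * t) / c - exp (c * 0) / c) {0..t}"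
      using c that by (intro fundamental_theorem_of_calculus)
        (auto intro!: derivative_eq_intros simp flip: has_real_derivative_iff_has_vector_derivative)
    then show ?thesis by (simp add: diff_divide_distrib)
  qed
  have contG: "continuous_on A G" for A
    using lip by (meson lipschitz_on_continuous_on lipschitz_on_subset subset_UNIV)
  have G_bound: "norm (G y) \<le> norm (G 0) + L * norm y" for y
  proof -
    have "norm (G y - G 0) \<le> L * norm y"
      using lipschitz_onD[OF lip, of y 0] by (simp add: dist_norm)
    then show ?thesis using norm_triangle_ineq2[of "G y" "G 0"] by linarith
  qed
  define g where "g u s = G (exp (c * s) *\<^sub>R apply_bcontfun u s)" for u :: "real \<Rightarrow>\<^sub>C 'a" and s
  have contg: "continuous_on A (g u)" for A u
    unfolding g_def
    by (rule continuous_on_compose2[OF contG[of UNIV]]) (auto intro!: continuous_intros)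
  have intg: "g u integrable_on {0..t}" for u t
    by (intro integrable_continuous_interval contg)
  \<comment> \<open>The Picard operator in the weighted variable. Bounded continuous functions live
    on the whole line, so negative times are sent to 0.\<close>
  define \<Psi> where "\<Psi> u t = exp (- c * max 0 t) *\<^sub>R (q + integral {0..max 0 t} (g u))" for u t
  have cont\<Psi>: "continuous_on UNIV (\<Psi> u)" for u
  proof -
    have "continuous_on {0..} (\<lambda>t. integral {0..t} (g u))"
      by (rule continuous_on_vector_derivative[of _ _ "g u"])
         (auto intro!: integral_has_vector_derivative_atLeast contg)
    then have "continuous_on UNIV (\<lambda>t. integral {0..max 0 t} (g u))"
      by (rule continuous_on_compose2[of _ _ _ "max 0"]) (auto intro!: continuous_intros)
    then show ?thesis unfolding \<Psi>_def by (intro continuous_intros)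
  qed
  \<comment> \<open>The integrand grows at most like \<open>exp (c * r)\<close>, which the weight
    compensates; hence the operator stays within the bounded functions.\<close>
  have bounded\<Psi>: "norm (\<Psi> u t) \<le> norm q + (norm (G 0) + L * K) / c"
    if K: "\<And>s. norm (apply_bcontfun u s) \<le> K" for u t K
  proof -
    define s where "s = max 0 t"
    have s: "s \<ge> 0" by (simp add: s_def)
    have K0: "K \<ge> 0" using K[of 0] by (meson norm_ge_zero order_trans)
    have bound: "norm (g u r) \<le> (norm (G 0) + L * K) * exp (c * r)" if "r \<in> {0..s}" for r
    proof -
      have "norm (g u r) \<le> norm (G 0) + L * (exp (c * r) * norm (apply_bcontfun u r))"
        using G_bound[of "exp (c * r) *\<^sub>R apply_bcontfun u r"] by (simp add: g_def)
      also have "\<dots> \<le> norm (G 0) * exp (c * r) + L * (exp (c * r) * K)"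
        using that c L K by (intro add_mono mult_left_mono mult_right_le_one_le) (auto simp: mult_le_cancel_left1 zero_le_mult_iff)
      finally show ?thesis by (simp add: algebra_simps)
    qed
    have int: "((\<lambda>r. (norm (G 0) + L * K) * exp (c * r)) has_integral
        (norm (G 0) + L * K) * ((exp (c * s) - 1) / c)) {0..s}"
      by (rule has_integral_mult_right[OF exp_int[OF s]])
    have "norm (integral {0..s} (g u)) \<le> (norm (G 0) + L * K) * ((exp (c * s) - 1) / c)"
      using integral_norm_bound_integral[OF intg has_integral_integrable[OF int] bound]
      unfolding integral_unique[OF int] .
    also have "\<dots> \<le> (norm (G 0) + L * K) * (exp (c * s) / c)"
      using c L K0 by (intro mult_left_mono divide_right_mono) auto
    finally have "exp (- c * s) * norm (integral {0..s} (g u)) \<le> exp (- c * s) * ((norm (G 0) + L * K) * (exp (c * s) / c))"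
      by (intro mult_left_mono) auto
    also have "\<dots> = (norm (G 0) + L * K) / c * (exp (- c * s) * exp (c * s))" by (simp only: divide_inverse mult_ac)
    also have "\<dots> = (norm (G 0) + L * K) / c" by (simp add: mult_exp_exp)
    finally have *: "exp (- c * s) * norm (integral {0..s} (g u)) \<le> (norm (G 0) + L * K) / c" .
    have "norm (\<Psi> u t) \<le> exp (- c * s) * norm q + exp (- c * s) * norm (integral {0..s} (g u))"
      unfolding \<Psi>_def s_def[symmetric]
      by (simp add: norm_triangle_ineq mult_left_mono flip: distrib_left)
    also have "exp (- c * s) * norm q \<le> 1 * norm q"
      using c s by (intro mult_right_mono) auto
    finally show ?thesis using * by linarith
  qed
  define \<Phi> where "\<Phi> u = Bcontfun (\<Psi> u)" for u
  have \<Phi>: "apply_bcontfun (\<Phi> u) = \<Psi> u" for u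
  proof -
    obtain K where "\<And>s. norm (apply_bcontfun u s) \<le> K"
      using bounded_apply_bcontfun[of u] by (auto simp: bounded_iff)
    from bounded\<Psi>[OF this] have "bounded (range (\<Psi> u))" by (auto simp: bounded_iff)
    then show ?thesis unfolding \<Phi>_def
      using cont\<Psi> by (intro Bcontfun_inverse) (auto simp: bcontfun_def)
  qed
  have contraction: "dist (\<Phi> u) (\<Phi> v) \<le> 1 / 2 * dist u v" for u v
  proof (rule dist_bound)
    fix t :: real
    define s where "s = max 0 t"
    have s: "s \<ge> 0" by (simp add: s_def)
    have bound: "norm (g u r - g v r) \<le> (L * dist u v) * exp (c * r)" for r
    proof -
      have "norm (g u r - g v r) \<le> L * (exp (c * r) * dist (apply_bcontfun u r) (apply_bcontfun v r))"
        using lipschitz_onD[OF lip, of "exp (c * r) *\<^sub>R apply_bcontfun u r" "exp (c * r) *\<^sub>R apply_bcontfun v r"]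
        by (simp add: g_def dist_norm flip: scaleR_diff_right)
      also have "\<dots> \<le> L * (exp (c * r) * dist u v)"
        using L by (intro mult_left_mono dist_bounded) auto
      finally show ?thesis by (simp add: algebra_simps)
    qed
    have int: "((\<lambda>r. (L * dist u v) * exp (c * r)) has_integral
        (L * dist u v) * ((exp (c * s) - 1) / c)) {0..s}"
      by (rule has_integral_mult_right[OF exp_int[OF s]])
    have "norm (integral {0..s} (\<lambda>r. g u r - g v r)) \<le> (L * dist u v) * ((exp (c * s) - 1) / c)"
      using integral_norm_bound_integral[OF integrable_diff[OF intg intg]
          has_integral_integrable[OF int] bound]
      unfolding integral_unique[OF int] .
    also have "\<dots> \<le> (L * dist u v) * (exp (c * s) / c)"
      using c L by (intro mult_left_mono divide_right_mono) auto
    finally have "exp (- c * s) * norm (integral {0..s} (\<lambda>r. g u r - g v r))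
        \<le> exp (- c * s) * ((L * dist u v) * (exp (c * s) / c))"
      by (intro mult_left_mono) auto
    also have "\<dots> = L / c * dist u v * (exp (- c * s) * exp (c * s))" by (simp only: divide_inverse mult_ac)
    also have "\<dots> = L / c * dist u v" by (simp add: mult_exp_exp)
    also have "\<dots> \<le> 1 / 2 * dist u v" by (intro mult_right_mono c) auto
    finally show "dist (apply_bcontfun (\<Phi> u) t) (apply_bcontfun (\<Phi> v) t) \<le> 1 / 2 * dist u v"
      unfolding \<Phi> \<Psi>_def s_def[symmetric] dist_norm
      by (simp add: integral_diff[OF intg intg] flip: scaleR_diff_right)
  qed
  obtain u where u: "\<Phi> u = u"
    using banach_fix_type[of "1/2" \<Phi>] contraction by auto
  define x where "x t = exp (c * t) *\<^sub>R apply_bcontfun u t" for t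
  have gx: "g u = (\<lambda>t. G (x t))" by (simp add: g_def x_def fun_eq_iff)
  have x_eq: "x t = q + integral {0..t} (g u)" if "t \<ge> 0" for t
  proof -
    have "x t = exp (c * t) *\<^sub>R \<Psi> u t" using \<Phi>[of u] u by (simp add: x_def)
    then show ?thesis using that by (simp add: \<Psi>_def flip: exp_add)
  qed
  have "(x has_vector_derivative G (x t)) (at t within {0..})" if "t \<ge> 0" for t
  proof (rule has_vector_derivative_transform[of t "{0..}" _ "\<lambda>t. q + integral {0..t} (g u)"])
    show "((\<lambda>t. q + integral {0..t} (g u)) has_vector_derivative G (x t)) (at t within {0..})"
      using integral_has_vector_derivative_atLeast[OF contg that, of u]
      by (auto intro!: derivative_eq_intros simp: gx)
  qed (use that x_eq in auto)
  then show ?thesis using x_eq[of 0] by (auto simp: solution_on_def)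
qed

section \<open>Trapping and convergence near the equilibrium\<close>

lemma solution_on_subset: "solution_on F D I x \<Longrightarrow> J \<subseteq> I \<Longrightarrow> solution_on F D J x"
  unfolding solution_on_def by (meson has_vector_derivative_within_subset subsetD)

text \<open>Dissipation is required on a ball only. The field is a parameter because the results are
  used for a linear field about 0, for a nonlinear field near its equilibrium, and for the same
  field cut off outside the ball.\<close>

locale quadratic_lyapunov =
  fixes B :: "'a::euclidean_space \<Rightarrow> 'a \<Rightarrow> real" and a r :: real and p :: 'a
    and F :: "'a \<Rightarrow> 'a"
  assumes a_pos: "a > 0" and r_pos: "r > 0"
    and bilinear: "bounded_bilinear B" and symmetric: "symmetric_form B"
    and coercive: "(norm x)\<^sup>2 \<le> B x x"
    and dissipative: "x \<in> cball p r \<Longrightarrow> B (x - p) (F x) \<le> - a * B (x - p) (x - p)"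
begin

lemma sym: "B x y = B y x"
  using symmetric by (simp add: symmetric_form_def)

text \<open>\<open>exp (2 * a * t) * B (x t - p) (x t - p)\<close> is nonincreasing. The solution
  has to be in the ball at interior times only, so that the bound still reaches a first exit
  time.\<close>

lemma B_decay:
  assumes sol: "solution_on F D {0..\<tau>} x" and "0 \<le> \<tau>"
    and inside: "\<And>t. 0 < t \<Longrightarrow> t < \<tau> \<Longrightarrow> x t \<in> cball p r"
  shows "B (x \<tau> - p) (x \<tau> - p) \<le> exp (- 2 * a * \<tau>) * B (x 0 - p) (x 0 - p)"
proof -
  define V where "V t = exp (2 * a * t) * B (x t - p) (x t - p)" for t
  have x': "(x has_vector_derivative F (x t)) (at t within {0..\<tau>})" if "t \<in> {0..\<tau>}" for t
    using sol that by (auto simp: solution_on_def)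
  then have "continuous_on {0..\<tau>} x" by (rule continuous_on_vector_derivative)
  then have "continuous_on {0..\<tau>} V"
    unfolding V_def
    by (intro continuous_intros bounded_bilinear.continuous_on[OF bilinear])
  moreover have "\<exists>y. (V has_real_derivative y) (at t) \<and> y \<le> 0" if t: "0 < t" "t < \<tau>" for t
  proof -
    have "(x has_vector_derivative F (x t)) (at t)"
      using x'[of t] t at_within_Icc_at[OF t] by auto
    then have xp: "((\<lambda>t. x t - p) has_vector_derivative F (x t)) (at t)"
      by (auto intro!: derivative_eq_intros)
    have "((\<lambda>t. B (x t - p) (x t - p)) has_real_derivative
        B (x t - p) (F (x t)) + B (F (x t)) (x t - p)) (at t)"
      using bounded_bilinear.has_vector_derivative[OF bilinear xp xp]
      by (simp add: has_real_derivative_iff_has_vector_derivative)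
    then have "(V has_real_derivative 2 * a * exp (2 * a * t) * B (x t - p) (x t - p) +
        exp (2 * a * t) * (2 * B (x t - p) (F (x t)))) (at t)"
      unfolding V_def by (auto intro!: derivative_eq_intros simp: sym[of "F (x t)"])
    moreover have "2 * a * exp (2 * a * t) * B (x t - p) (x t - p) +
        exp (2 * a * t) * (2 * B (x t - p) (F (x t))) =
        2 * exp (2 * a * t) * (a * B (x t - p) (x t - p) + B (x t - p) (F (x t)))"
      by (simp add: algebra_simps)
    moreover have "\<dots> \<le> 0"
      using dissipative[OF inside[OF t]] by (intro mult_nonneg_nonpos) auto
    ultimately show ?thesis by metis
  qed
  ultimately have "V \<tau> \<le> V 0"
    using DERIV_nonpos_imp_decreasing_open[of 0 \<tau> V] \<open>0 \<le> \<tau>\<close> by blast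
  then have "exp (- 2 * a * \<tau>) * V \<tau> \<le> exp (- 2 * a * \<tau>) * V 0"
    by (intro mult_left_mono) auto
  moreover have "exp (- 2 * a * \<tau>) * V \<tau> = B (x \<tau> - p) (x \<tau> - p)"
    by (simp add: V_def exp_minus)
  moreover have "V 0 = B (x 0 - p) (x 0 - p)" by (simp add: V_def)
  ultimately show ?thesis by metis
qed

lemma B_nonneg: "0 \<le> B x x"
  using coercive[of x] zero_le_power2[of "norm x"] by linarith

lemma B_le: obtains K where "K > 0" "\<And>x. B x x \<le> K * (norm x)\<^sup>2"
proof -
  obtain K where "K > 0" "\<And>x y. norm (B x y) \<le> norm x * norm y * K"
    using bounded_bilinear.pos_bounded[OF bilinear] by blast
  then have "B x x \<le> K * (norm x)\<^sup>2" for x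
    by (metis abs_le_D1 mult.commute power2_eq_square real_norm_def)
  then show thesis using that \<open>K > 0\<close> by blast
qed

text \<open>First exit argument: the times at distance at least \<epsilon> form a closed set, so
  there is an earliest one. Up to it \<open>B\<close> has not increased, and coercivity with
  constant 1 contradicts the distance there.\<close>

lemma trapped:
  assumes sol: "solution_on F D {0..\<tau>} x" and "0 < \<epsilon>" "\<epsilon> \<le> r"
    and start: "B (x 0 - p) (x 0 - p) < \<epsilon>\<^sup>2" and "t \<in> {0..\<tau>}"
  shows "dist (x t) p < \<epsilon>"
proof (rule ccontr)
  assume contra: "\<not> dist (x t) p < \<epsilon>"
  define Z where "Z = {0..\<tau>} \<inter> (\<lambda>t. dist (x t) p) -` {\<epsilon>..}"
  have "continuous_on {0..\<tau>} x"
    using sol by (intro continuous_on_vector_derivative[of _ _ "\<lambda>t. F (x t)"]) (auto simp: solution_on_def)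
  then have "closed Z" unfolding Z_def
    by (intro continuous_closed_preimage continuous_intros) auto
  moreover have "Z \<noteq> {}" "bdd_below Z" using contra assms by (auto simp: Z_def)
  ultimately have "Inf Z \<in> Z" by (intro closed_contains_Inf)
  define s where "s = Inf Z"
  have s: "0 \<le> s" "s \<le> \<tau>" "\<epsilon> \<le> dist (x s) p"
    using \<open>Inf Z \<in> Z\<close> by (auto simp: s_def Z_def)
  have before: "dist (x u) p < \<epsilon>" if "0 < u" "u < s" for u
  proof (rule ccontr)
    assume "\<not> dist (x u) p < \<epsilon>"
    then have "u \<in> Z" using that s by (auto simp: Z_def)
    then show False using cInf_lower[OF _ \<open>bdd_below Z\<close>] that by (force simp: s_def)
  qed
  have "B (x s - p) (x s - p) \<le> exp (- 2 * a * s) * B (x 0 - p) (x 0 - p)"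
    using before \<open>\<epsilon> \<le> r\<close> s
    by (intro B_decay[OF solution_on_subset[OF sol]]) (force simp: dist_commute)+
  also have "\<dots> \<le> 1 * B (x 0 - p) (x 0 - p)"
    using a_pos s by (intro mult_right_mono B_nonneg) auto
  also have "\<dots> < \<epsilon>\<^sup>2" using start by simp
  finally have "(norm (x s - p))\<^sup>2 < \<epsilon>\<^sup>2" using coercive order_le_less_trans by blast
  moreover have "\<epsilon>\<^sup>2 \<le> (norm (x s - p))\<^sup>2"
    using s \<open>0 < \<epsilon>\<close> by (intro power_mono) (auto simp: dist_norm)
  ultimately show False by simp
qed

lemma exponential_decay:
  assumes sol: "solution_on F D {0..} x" and start: "B (x 0 - p) (x 0 - p) < r\<^sup>2" and "0 \<le> t"
  shows "(norm (x t - p))\<^sup>2 \<le> exp (- 2 * a * t) * B (x 0 - p) (x 0 - p)"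
proof -
  have sub: "solution_on F D {0..\<tau>} x" for \<tau>
    by (rule solution_on_subset[OF sol]) auto
  have "dist (x t) p < r" if "0 \<le> t" for t
    using trapped[OF sub[of t] r_pos _ start] that by auto
  then have "B (x t - p) (x t - p) \<le> exp (- 2 * a * t) * B (x 0 - p) (x 0 - p)"
    using \<open>0 \<le> t\<close> by (intro B_decay[OF sub]) (auto simp: dist_commute less_imp_le)
  then show ?thesis using coercive order_trans by blast
qed

lemma converges:
  assumes sol: "solution_on F D {0..} x" and start: "B (x 0 - p) (x 0 - p) < r\<^sup>2"
  shows "(x \<longlongrightarrow> p) at_top"
proof -
  note le = exponential_decay[OF assms]
  have "((\<lambda>t. exp (- 2 * a * t) * B (x 0 - p) (x 0 - p)) \<longlongrightarrow> 0 * B (x 0 - p) (x 0 - p)) at_top"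
    using a_pos
    by (intro tendsto_mult tendsto_const filterlim_compose[OF exp_at_bot]
        filterlim_tendsto_neg_mult_at_bot[OF tendsto_const _ filterlim_ident]) auto
  then have "((\<lambda>t. exp (- 2 * a * t) * B (x 0 - p) (x 0 - p)) \<longlongrightarrow> 0) at_top" by simp
  then have "((\<lambda>t. (norm (x t - p))\<^sup>2) \<longlongrightarrow> 0) at_top"
    by (rule Lim_null_comparison[rotated])
       (use le in \<open>auto simp: eventually_at_top_linorder intro!: exI[of _ 0]\<close>)
  then have "((\<lambda>t. sqrt ((norm (x t - p))\<^sup>2)) \<longlongrightarrow> sqrt 0) at_top"
    by (rule tendsto_real_sqrt)
  then have "((\<lambda>t. x t - p) \<longlongrightarrow> 0) at_top"
    by (simp add: tendsto_norm_zero_iff)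
  then show ?thesis by (simp add: LIM_zero_iff)
qed

lemma start_small:
  assumes "\<epsilon> > 0"
  obtains \<delta> where "\<delta> > 0" "\<And>x. dist x p < \<delta> \<Longrightarrow> B (x - p) (x - p) < \<epsilon>\<^sup>2"
proof -
  obtain K where K: "K > 0" "\<And>x. B x x \<le> K * (norm x)\<^sup>2" using B_le by blast
  have "B (x - p) (x - p) < \<epsilon>\<^sup>2" if "dist x p < \<epsilon> / sqrt K" for x
  proof -
    have "norm (x - p) * sqrt K < \<epsilon>" using that K by (simp add: dist_norm field_simps)
    then have "(norm (x - p) * sqrt K)\<^sup>2 < \<epsilon>\<^sup>2"
      using K by (intro power_strict_mono) auto
    then show ?thesis using K order_le_less_trans[OF K(2)]
      by (simp add: power_mult_distrib mult.commute)
  qed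
  then show thesis using that[of "\<epsilon> / sqrt K"] K assms by simp
qed

text \<open>Composing \<open>F\<close> with the projection onto the ball gives a globally Lipschitz field; its
  solutions that start near \<open>p\<close> never leave the ball, so they solve the original equation.\<close>

lemma local_solution_exists:
  assumes lip: "L-lipschitz_on (cball p r) F" and start: "B (q - p) (q - p) < r\<^sup>2"
  shows "\<exists>x. solution_on F UNIV {0..} x \<and> x 0 = q"
proof -
  define c where "c = closest_point (cball p r)"
  have "1-lipschitz_on UNIV c"
    using r_pos closest_point_lipschitz[of "cball p r"] by (auto simp: lipschitz_on_def c_def)
  moreover have "c ` UNIV \<subseteq> cball p r"
    using r_pos by (auto simp: c_def intro!: closest_point_in_set)
  ultimately have "(L * 1)-lipschitz_on UNIV (\<lambda>x. F (c x))"
    using lip by (intro lipschitz_on_compose2) (auto intro: lipschitz_on_subset)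
  then obtain x where x: "solution_on (\<lambda>x. F (c x)) UNIV {0..} x" "x 0 = q"
    using lipschitz_solution_exists by blast
  have c: "c y = y" if "y \<in> cball p r" for y
    using that by (simp add: c_def closest_point_self)
  interpret cut: quadratic_lyapunov B a r p "\<lambda>x. F (c x)"
    using dissipative c
    by (intro quadratic_lyapunov.intro a_pos r_pos bilinear symmetric coercive) simp
  have "dist (x t) p < r" if "0 \<le> t" for t
    using cut.trapped[OF solution_on_subset[OF x(1), of "{0..t}"] r_pos order_refl, of t] start x(2) that
    by auto
  then have "F (c (x t)) = F (x t)" if "0 \<le> t" for t
    using that by (simp add: c dist_commute less_imp_le)
  then have "solution_on F UNIV {0..} x"
    using x(1) by (auto simp: solution_on_def)
  then show ?thesis using x(2) by blast
qed

lemma locally_asymptotically_stable: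
  assumes lip: "L-lipschitz_on (cball p r) F" and "F p = 0"
  shows "locally_asymptotically_stable F UNIV p"
  unfolding locally_asymptotically_stable_def
proof
  have "\<exists>\<delta>>0. \<forall>x \<tau>. solution_on F UNIV {0..\<tau>} x \<longrightarrow> dist (x 0) p < \<delta> \<longrightarrow>
      (\<forall>t\<in>{0..\<tau>}. dist (x t) p < \<epsilon>)" if "\<epsilon> > 0" for \<epsilon>
  proof -
    \<comment> \<open>Trapping works only for radii up to \<open>r\<close>, where dissipation
      holds.\<close>
    have \<epsilon>: "min \<epsilon> r > 0" using that r_pos by simp
    obtain \<delta> where "\<delta> > 0" "\<And>x. dist x p < \<delta> \<Longrightarrow> B (x - p) (x - p) < (min \<epsilon> r)\<^sup>2"
      using start_small[OF \<epsilon>] by metis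
    then show ?thesis using trapped[OF _ \<epsilon>]
      by (intro exI[of _ \<delta>]) (auto simp: min_less_iff_conj)
  qed
  then show "stable_equilibrium F UNIV p"
    using \<open>F p = 0\<close> by (simp add: stable_equilibrium_def)
  obtain \<delta> where \<delta>: "\<delta> > 0" "\<And>x. dist x p < \<delta> \<Longrightarrow> B (x - p) (x - p) < r\<^sup>2"
    using start_small[OF r_pos] by metis
  have "attracts F UNIV p (UNIV \<inter> ball p \<delta>)"
    unfolding attracts_def
    using \<delta>(2) converges local_solution_exists[OF lip] by (auto simp: dist_commute)
  then show "\<exists>\<delta>>0. attracts F UNIV p (UNIV \<inter> ball p \<delta>)" using \<delta>(1) by blast
qed

end

section \<open>Frequency response and gain\<close>

lemma complex_eigenvalue_in_spectrum:
  assumes "complex_eigenvalue (\<lambda>x. A *v x) \<mu>"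
  shows "\<mu> \<in> spectrum A"
proof -
  obtain x y where xy: "(x, y) \<noteq> 0" "A *v x = Re \<mu> *\<^sub>R x - Im \<mu> *\<^sub>R y"
      "A *v y = Im \<mu> *\<^sub>R x + Re \<mu> *\<^sub>R y"
    using assms by (auto simp: complex_eigenvalue_def cmap_def cscale_def)
  define c where "c = (\<chi> i. Complex (x $ i) (y $ i))"
  have "(map_matrix complex_of_real A *v c) $ i = (\<mu> *s c) $ i" for i
  proof -
    have "(map_matrix complex_of_real A *v c) $ i = Complex ((A *v x) $ i) ((A *v y) $ i)"
      by (simp add: matrix_vector_mult_def c_def complex_eq_iff map_matrix_def)
    also have "\<dots> = (\<mu> *s c) $ i"
      unfolding xy by (simp add: c_def complex_eq_iff)
    finally show ?thesis .
  qed
  then have "map_matrix complex_of_real A *v c = \<mu> *s c" by (simp add: vec_eq_iff)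
  moreover have "c \<noteq> 0"
    using xy(1) by (auto simp: c_def vec_eq_iff complex_eq_iff zero_prod_def)
  ultimately show ?thesis by (auto simp: spectrum_def)
qed

section \<open>Free decay and forced response of a linear cell\<close>

lemma matrix_vector_lipschitz: "\<exists>L. L-lipschitz_on UNIV (\<lambda>x. A *v x)" for A :: "real^'n^'n"
  using bounded_linear.lipschitz_boundE[OF matrix_vector_mul_bounded_linear] by blast

lemma hurwitz_solution_decays:
  fixes A :: "real^'n^'n"
  assumes "hurwitz A"
  obtains \<phi> K a where "solution_on (\<lambda>x. A *v x) UNIV {0..} \<phi>" "\<phi> 0 = q" "K \<ge> 0" "a > 0"
    "\<And>t. t \<ge> 0 \<Longrightarrow> (norm (\<phi> t))\<^sup>2 \<le> exp (- 2 * a * t) * K"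
proof -
  have lin: "linear (\<lambda>x. A *v x)" by simp
  have neg: "Re \<mu> < 0" if "complex_eigenvalue (\<lambda>x. A *v x) \<mu>" for \<mu>
    using assms complex_eigenvalue_in_spectrum[OF that] by (simp add: hurwitz_def)
  obtain B a where
    B: "a > 0" "bounded_bilinear B" "symmetric_form B" "\<And>x. (norm x)\<^sup>2 \<le> B x x"
      "\<And>x. B x (A *v x) \<le> - a * B x x"
    using quadratic_lyapunov_function[OF lin] neg by blast
  obtain \<phi> where \<phi>: "solution_on (\<lambda>x. A *v x) UNIV {0..} \<phi>" "\<phi> 0 = q"
    using matrix_vector_lipschitz lipschitz_solution_exists by blast
  \<comment> \<open>A linear field is dissipative on every ball, so the radius is simply taken large
    enough for the start: \<open>B q q < r \<le> r^2\<close>.\<close>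
  define r where "r = B q q + 1"
  have "B q q \<ge> 0" using B(4)[of q] zero_le_power2[of "norm q"] by linarith
  then have "r \<ge> 1" "B q q < r" by (simp_all add: r_def)
  then have r: "r > 0" "B q q < r\<^sup>2" using self_le_power[of r 2] by simp_all
  interpret quadratic_lyapunov B a r 0 "\<lambda>x. A *v x"
    using B(5) by (intro quadratic_lyapunov.intro B(1-4) r(1)) simp
  show thesis
    using that[OF \<phi>, of "B q q" a] exponential_decay[OF \<phi>(1)] r \<phi>(2) B(1) B_nonneg by simp
qed

text \<open>Gains refer to trajectories on the half line, so the response is continued after
  \<open>T\<close> by the free motion from \<open>\<xi> T\<close>. The integrated equation tolerates
  the jump of the input at \<open>T\<close>.\<close>

lemma forced_trajectory_extension:
  fixes A :: "real^'n^'n"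
  assumes "T \<ge> 0"
    and \<xi>': "\<And>t. t \<in> {0..T} \<Longrightarrow> (\<xi> has_vector_derivative A *v \<xi> t + v t *\<^sub>R B) (at t within {0..T})"
  obtains \<xi>' where "\<And>t. t \<in> {0..T} \<Longrightarrow> \<xi>' t = \<xi> t"
    "forced_trajectory A B (\<lambda>t. if t \<in> {0..T} then v t else 0) \<xi>'"
proof -
  obtain \<zeta> where \<zeta>: "solution_on (\<lambda>x. A *v x) UNIV {0..} \<zeta>" "\<zeta> 0 = \<xi> T"
    using matrix_vector_lipschitz lipschitz_solution_exists by blast
  define w where "w t = (if t \<in> {0..T} then v t else 0)" for t
  define \<eta> where "\<eta> t = (if t \<le> T then \<xi> t else \<zeta> (t - T))" for t
  have \<eta>T: "\<eta> t = \<zeta> (t - T)" if "t \<ge> T" for t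
    using that \<zeta>(2) by (cases "t = T") (auto simp: \<eta>_def)
  have \<eta>1: "(\<eta> has_vector_derivative A *v \<eta> t + v t *\<^sub>R B) (at t within {0..T})" if "t \<in> {0..T}" for t
    by (rule has_vector_derivative_transform[OF that _ _ ])
       (use \<xi>'[OF that] that in \<open>auto simp: \<eta>_def\<close>)
  have \<eta>2: "(\<eta> has_vector_derivative A *v \<eta> t) (at t within {T..})" if "t \<ge> T" for t
  proof (rule has_vector_derivative_transform[of t "{T..}" _ "\<lambda>t. \<zeta> (t - T)"])
    have "(\<zeta> has_vector_derivative A *v \<zeta> (t - T)) (at (t - T) within {0..})"
      using \<zeta>(1) that by (auto simp: solution_on_def)
    then have "(\<zeta> has_vector_derivative A *v \<zeta> (t - T)) (at (t - T) within (\<lambda>t. t - T) ` {T..})"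
      by (rule has_vector_derivative_within_subset) auto
    moreover have "((\<lambda>t. t - T) has_vector_derivative 1) (at t within {T..})"
      by (auto intro!: derivative_eq_intros)
    ultimately have "(\<zeta> \<circ> (\<lambda>t. t - T) has_vector_derivative 1 *\<^sub>R (A *v \<zeta> (t - T))) (at t within {T..})"
      by (intro vector_diff_chain_within)
    then show "((\<lambda>t. \<zeta> (t - T)) has_vector_derivative A *v \<eta> t) (at t within {T..})"
      using that by (simp add: o_def \<eta>T)
  qed (use that \<eta>T in auto)
  have "continuous_on ({0..T} \<union> {T..}) \<eta>"
    using \<eta>1 \<eta>2
    by (intro continuous_on_closed_Un continuous_on_vector_derivative[of "{0..T}"]
        continuous_on_vector_derivative[of "{T..}"]) (auto simp del: atLeastAtMost_iff)
  moreover have "{0..T} \<union> {T..} = {0..}" using \<open>T \<ge> 0\<close> by auto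
  ultimately have cont: "continuous_on {0..} \<eta>" by simp
  have int1: "((\<lambda>s. A *v \<eta> s + w s *\<^sub>R B) has_integral (\<eta> t - \<eta> 0)) {0..t}" if "0 \<le> t" "t \<le> T" for t
  proof -
    have "((\<lambda>s. A *v \<eta> s + v s *\<^sub>R B) has_integral (\<eta> t - \<eta> 0)) {0..t}"
      using that
      by (intro fundamental_theorem_of_calculus)
         (auto intro: has_vector_derivative_within_subset[OF \<eta>1])
    then show ?thesis
      by (rule has_integral_eq[rotated]) (use that in \<open>auto simp: w_def\<close>)
  qed
  have int2: "((\<lambda>s. A *v \<eta> s + w s *\<^sub>R B) has_integral (\<eta> t - \<eta> T)) {T..t}" if "T \<le> t" for t
  proof -
    have "((\<lambda>s. A *v \<eta> s) has_integral (\<eta> t - \<eta> T)) {T..t}"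
      using that
      by (intro fundamental_theorem_of_calculus)
         (auto intro: has_vector_derivative_within_subset[OF \<eta>2])
    \<comment> \<open>The truncated input still equals \<open>v T\<close> at the single time
      \<open>T\<close>, a null set.\<close>
    then show ?thesis
      by (rule has_integral_spike_finite[of "{T}", rotated 2]) (auto simp: w_def)
  qed
  have "((\<lambda>s. A *v \<eta> s + w s *\<^sub>R B) has_integral (\<eta> t - \<eta> 0)) {0..t}" if "0 \<le> t" for t
  proof (cases "t \<le> T")
    case True
    then show ?thesis using int1 that by blast
  next
    case False
    then have "((\<lambda>s. A *v \<eta> s + w s *\<^sub>R B) has_integral ((\<eta> T - \<eta> 0) + (\<eta> t - \<eta> T))) {0..t}"
      using \<open>T \<ge> 0\<close> by (intro has_integral_combine[OF _ _ int1 int2]) auto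
    then show ?thesis by simp
  qed
  then show thesis
    using that[of \<eta>] cont by (simp add: forced_trajectory_def w_def \<eta>_def)
qed

lemma L2_norm_power2: "(L2_norm v)\<^sup>2 = (LINT t:{0..}|lborel. (v t)\<^sup>2)"
  unfolding L2_norm_def
  by (intro real_sqrt_pow2) (simp add: set_lebesgue_integral_def)

lemma in_L2_truncation:
  assumes "continuous_on {0..T} v"
  shows "in_L2 (\<lambda>t. if t \<in> {0..T} then v t else 0)" (is "in_L2 ?w")
    and "(L2_norm (\<lambda>t. if t \<in> {0..T} then v t else 0))\<^sup>2 = integral {0..T} (\<lambda>t. (v t)\<^sup>2)"
proof -
  have "set_integrable lborel {0..T} v"
    using assms by (rule borel_integrable_atLeastAtMost')
  then have "(\<lambda>t. indicator {0..T} t *\<^sub>R v t) \<in> borel_measurable lborel"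
    by (simp add: set_integrable_def borel_measurable_integrable)
  moreover have "(\<lambda>t. indicator {0..} t *\<^sub>R ?w t) = (\<lambda>t. indicator {0..T} t *\<^sub>R v t)"
    by (auto simp: fun_eq_iff indicator_def)
  ultimately have meas: "set_borel_measurable lborel {0..} ?w"
    by (simp add: set_borel_measurable_def)
  have int: "set_integrable lborel {0..T} (\<lambda>t. (v t)\<^sup>2)"
    by (intro borel_integrable_atLeastAtMost' continuous_intros assms)
  have eq: "(\<lambda>t. indicator {0..} t *\<^sub>R (?w t)\<^sup>2) = (\<lambda>t. indicator {0..T} t *\<^sub>R (v t)\<^sup>2)"
    by (auto simp: fun_eq_iff indicator_def)
  show "in_L2 ?w" using meas int unfolding in_L2_def set_integrable_def eq by simp
  have "(LINT t:{0..}|lborel. (?w t)\<^sup>2) = (LINT t:{0..T}|lborel. (v t)\<^sup>2)"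
    unfolding set_lebesgue_integral_def eq ..
  also have "\<dots> = integral {0..T} (\<lambda>t. (v t)\<^sup>2)"
    using set_borel_integral_eq_integral(2)[OF int] .
  finally show "(L2_norm ?w)\<^sup>2 = integral {0..T} (\<lambda>t. (v t)\<^sup>2)" by (simp add: L2_norm_power2)
qed

text \<open>The input is cut off at \<open>T\<close>, which leaves the output up to \<open>T\<close>
  unchanged; the output energy after \<open>T\<close> is nonnegative and is dropped.\<close>

lemma L2_gain_bound_on_interval:
  fixes A :: "real^'n^'n"
  assumes gain: "L2_gain_bound A B C \<gamma>" and "T \<ge> 0" "continuous_on {0..T} v" "\<xi> 0 = 0"
    and \<xi>': "\<And>t. t \<in> {0..T} \<Longrightarrow> (\<xi> has_vector_derivative A *v \<xi> t + v t *\<^sub>R B) (at t within {0..T})"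
  shows "integral {0..T} (\<lambda>t. (C \<bullet> \<xi> t)\<^sup>2) \<le> \<gamma>\<^sup>2 * integral {0..T} (\<lambda>t. (v t)\<^sup>2)"
proof -
  let ?w = "\<lambda>t. if t \<in> {0..T} then v t else 0"
  obtain \<eta> where \<eta>: "\<And>t. t \<in> {0..T} \<Longrightarrow> \<eta> t = \<xi> t" "forced_trajectory A B ?w \<eta>"
    using forced_trajectory_extension[OF assms(2) \<xi>'] by blast
  have "\<eta> 0 = 0" using \<eta>(1)[of 0] assms by simp
  then have out: "in_L2 (\<lambda>t. C \<bullet> \<eta> t)" "L2_norm (\<lambda>t. C \<bullet> \<eta> t) \<le> \<gamma> * L2_norm ?w" "\<gamma> \<ge> 0"
    using gain \<eta>(2) in_L2_truncation(1)[OF assms(3)] unfolding L2_gain_bound_def by blast+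
  have int: "set_integrable lborel {0..} (\<lambda>t. (C \<bullet> \<eta> t)\<^sup>2)"
    using out(1) by (simp add: in_L2_def)
  have sub: "set_integrable lborel {0..T} (\<lambda>t. (C \<bullet> \<eta> t)\<^sup>2)"
    by (rule set_integrable_subset[OF int]) auto
  have "integral {0..T} (\<lambda>t. (C \<bullet> \<xi> t)\<^sup>2) = integral {0..T} (\<lambda>t. (C \<bullet> \<eta> t)\<^sup>2)"
    using \<eta>(1) by (intro integral_cong) simp
  also have "\<dots> \<le> integral {0..} (\<lambda>t. (C \<bullet> \<eta> t)\<^sup>2)"
    using set_borel_integral_eq_integral(1)[OF int] set_borel_integral_eq_integral(1)[OF sub]
    by (intro integral_subset_le) auto
  also have "\<dots> = (L2_norm (\<lambda>t. C \<bullet> \<eta> t))\<^sup>2"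
    using set_borel_integral_eq_integral(2)[OF int] by (simp add: L2_norm_power2)
  also have "\<dots> \<le> (\<gamma> * L2_norm ?w)\<^sup>2"
    using out(2) by (intro power_mono) (auto simp: L2_norm_def set_lebesgue_integral_def)
  also have "\<dots> = \<gamma>\<^sup>2 * integral {0..T} (\<lambda>t. (v t)\<^sup>2)"
    by (simp only: power_mult_distrib in_L2_truncation(2)[OF assms(3)])
  finally show ?thesis .
qed


lemma hurwitz_output_energy_bounded:
  fixes A :: "real^'n^'n"
  assumes "hurwitz A"
  obtains \<phi> M where "solution_on (\<lambda>x. A *v x) UNIV {0..} \<phi>" "\<phi> 0 = q"
    "\<And>T. T \<ge> 0 \<Longrightarrow> integral {0..T} (\<lambda>t. (C \<bullet> \<phi> t)\<^sup>2) \<le> M"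
proof -
  obtain \<phi> K a where \<phi>: "solution_on (\<lambda>x. A *v x) UNIV {0..} \<phi>" "\<phi> 0 = q" and "K \<ge> 0" "a > 0"
    and decay: "\<And>t. t \<ge> 0 \<Longrightarrow> (norm (\<phi> t))\<^sup>2 \<le> exp (- 2 * a * t) * K"
    using hurwitz_solution_decays[OF assms, of q] by blast
  \<comment> \<open>The factor \<open>1 / (2 * a)\<close> is the integral of
    \<open>exp (- 2 * a * t)\<close> over the half line.\<close>
  define M where "M = (norm C)\<^sup>2 * K / (2 * a)"
  have cont: "continuous_on {0..T} \<phi>" for T
    using \<phi>(1) by (intro continuous_on_subset[OF continuous_on_vector_derivative[of "{0..}" \<phi> "\<lambda>t. A *v \<phi> t"]])
      (auto simp: solution_on_def)
  have "integral {0..T} (\<lambda>t. (C \<bullet> \<phi> t)\<^sup>2) \<le> M" if "T \<ge> 0" for T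
  proof -
    have int: "((\<lambda>t. (norm C)\<^sup>2 * K * exp (- 2 * a * t)) has_integral
        M * - exp (- 2 * a * T) - M * - exp (- 2 * a * 0)) {0..T}"
      using \<open>a > 0\<close> that by (intro fundamental_theorem_of_calculus)
        (auto intro!: derivative_eq_intros simp: M_def simp flip: has_real_derivative_iff_has_vector_derivative)
    have le: "(C \<bullet> \<phi> t)\<^sup>2 \<le> (norm C)\<^sup>2 * K * exp (- 2 * a * t)" if "t \<in> {0..T}" for t
    proof -
      have "(C \<bullet> \<phi> t)\<^sup>2 \<le> (norm C * norm (\<phi> t))\<^sup>2"
        by (metis Cauchy_Schwarz_ineq2 abs_ge_zero power2_abs power_mono)
      also have "\<dots> \<le> (norm C)\<^sup>2 * (exp (- 2 * a * t) * K)"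
        using decay[of t] that by (simp add: power_mult_distrib mult_left_mono)
      finally show ?thesis by (simp add: mult_ac)
    qed
    have "(\<lambda>t. (C \<bullet> \<phi> t)\<^sup>2) integrable_on {0..T}"
      by (intro integrable_continuous_interval continuous_intros cont)
    then have "integral {0..T} (\<lambda>t. (C \<bullet> \<phi> t)\<^sup>2) \<le> M * - exp (- 2 * a * T) - M * - exp (- 2 * a * 0)"
      using integral_le[OF _ has_integral_integrable[OF int] le] unfolding integral_unique[OF int] by simp
    also have "\<dots> \<le> M"
      using \<open>K \<ge> 0\<close> \<open>a > 0\<close> by (simp add: M_def)
    finally show ?thesis .
  qed
  then show thesis using that \<phi> by blast
qed

text \<open>The pair \<open>(x, y)\<close> is an eigenmode \<open>x + \<i> y\<close> driven by the input amplitude \<open>u1 + \<i> u2\<close>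
  at the frequency \<open>\<alpha> + \<i> \<beta>\<close>. Switching the exponential input off at time \<open>T\<close>, the response is
  the mode up to a transient of bounded energy, while the energy of the mode is unbounded
  in \<open>T\<close>.\<close>

lemma L2_gain_bound_eigenmode:
  fixes A :: "real^'n^'n"
  assumes "hurwitz A" and gain: "L2_gain_bound A B C \<gamma>" and "\<alpha> \<ge> 0"
    and Ax: "A *v x + u1 *\<^sub>R B = \<alpha> *\<^sub>R x - \<beta> *\<^sub>R y"
    and Ay: "A *v y + u2 *\<^sub>R B = \<beta> *\<^sub>R x + \<alpha> *\<^sub>R y"
  shows "(C \<bullet> x)\<^sup>2 + (C \<bullet> y)\<^sup>2 \<le> \<gamma>\<^sup>2 * (u1\<^sup>2 + u2\<^sup>2)"
proof -
  \<comment> \<open>Real and imaginary part of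
    \<open>exp ((\<alpha> + \<i> \<beta>) t)\<close>.\<close>
  define ec es where "ec t = exp (\<alpha> * t) * cos (\<beta> * t)" and "es t = exp (\<alpha> * t) * sin (\<beta> * t)" for t
  have ec': "(ec has_real_derivative \<alpha> * ec t - \<beta> * es t) (at t within S)"
    and es': "(es has_real_derivative \<beta> * ec t + \<alpha> * es t) (at t within S)" for t S
    unfolding ec_def es_def by (auto intro!: derivative_eq_intros simp: algebra_simps)
  have cont: "continuous_on S ec" "continuous_on S es" for S
    unfolding ec_def es_def by (intro continuous_intros)+
  have ecs: "(ec t)\<^sup>2 + (es t)\<^sup>2 = (exp (\<alpha> * t))\<^sup>2" for t
    by (simp add: ec_def es_def power_mult_distrib flip: distrib_left)
  obtain \<phi> M1 where \<phi>: "solution_on (\<lambda>x. A *v x) UNIV {0..} \<phi>" "\<phi> 0 = x"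
    "\<And>T. T \<ge> 0 \<Longrightarrow> integral {0..T} (\<lambda>t. (C \<bullet> \<phi> t)\<^sup>2) \<le> M1"
    using hurwitz_output_energy_bounded[OF assms(1)] by blast
  obtain \<psi> M2 where \<psi>: "solution_on (\<lambda>x. A *v x) UNIV {0..} \<psi>" "\<psi> 0 = y"
    "\<And>T. T \<ge> 0 \<Longrightarrow> integral {0..T} (\<lambda>t. (C \<bullet> \<psi> t)\<^sup>2) \<le> M2"
    using hurwitz_output_energy_bounded[OF assms(1)] by blast
  have \<phi>': "(\<phi> has_vector_derivative A *v \<phi> t) (at t within {0..T})"
    and \<psi>': "(\<psi> has_vector_derivative A *v \<psi> t) (at t within {0..T})" if "t \<in> {0..T}" for t T
    using solution_on_subset[OF \<phi>(1), of "{0..T}"] solution_on_subset[OF \<psi>(1), of "{0..T}"] that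
    by (auto simp: solution_on_def)
  have cont\<phi>: "continuous_on {0..T} \<phi>" and cont\<psi>: "continuous_on {0..T} \<psi>" for T
    by (rule continuous_on_vector_derivative[OF \<phi>'], assumption)
       (rule continuous_on_vector_derivative[OF \<psi>'])
  \<comment> \<open>\<open>X + \<i> Z\<close> and \<open>v1 + \<i> v2\<close> are the amplitudes
    \<open>x + \<i> y\<close> and \<open>u1 + \<i> u2\<close> times that exponential.\<close>
  define X Z where "X t = ec t *\<^sub>R x - es t *\<^sub>R y" and "Z t = es t *\<^sub>R x + ec t *\<^sub>R y" for t
  define v1 v2 where "v1 t = ec t * u1 - es t * u2" and "v2 t = es t * u1 + ec t * u2" for t
  have contX: "continuous_on S X" "continuous_on S Z" "continuous_on S v1" "continuous_on S v2" for S
    unfolding X_def Z_def v1_def v2_def by (intro continuous_intros cont)+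
  have AX: "A *v X t + v1 t *\<^sub>R B = ec t *\<^sub>R (A *v x + u1 *\<^sub>R B) - es t *\<^sub>R (A *v y + u2 *\<^sub>R B)" for t
    unfolding X_def v1_def
    by (simp add: matrix_vector_mult_diff_distrib matrix_vector_mult_scaleR algebra_simps)
  have AZ: "A *v Z t + v2 t *\<^sub>R B = es t *\<^sub>R (A *v x + u1 *\<^sub>R B) + ec t *\<^sub>R (A *v y + u2 *\<^sub>R B)" for t
    unfolding Z_def v2_def
    by (simp add: matrix_vector_right_distrib matrix_vector_mult_scaleR algebra_simps)
  have X': "(X has_vector_derivative A *v X t + v1 t *\<^sub>R B) (at t within S)" for t S
    unfolding AX Ax Ay
    unfolding X_def using ec'[of t S] es'[of t S]
    by (auto intro!: derivative_eq_intros simp: algebra_simps)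
  have Z': "(Z has_vector_derivative A *v Z t + v2 t *\<^sub>R B) (at t within S)" for t S
    unfolding AZ Ax Ay
    unfolding Z_def using ec'[of t S] es'[of t S]
    by (auto intro!: derivative_eq_intros simp: algebra_simps)
  \<comment> \<open>Real and imaginary parts are added because the rotation cancels in the sum: both
    energies are constants times the same exponential, so only \<open>G\<close> and \<open>V\<close>
    have to be compared.\<close>
  define G V where "G = (C \<bullet> x)\<^sup>2 + (C \<bullet> y)\<^sup>2" and "V = u1\<^sup>2 + u2\<^sup>2"
  have energy_out: "(C \<bullet> X t)\<^sup>2 + (C \<bullet> Z t)\<^sup>2 = G * (exp (\<alpha> * t))\<^sup>2"
    and energy_in: "(v1 t)\<^sup>2 + (v2 t)\<^sup>2 = V * (exp (\<alpha> * t))\<^sup>2" for t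
    unfolding ecs[symmetric]
    by (simp_all add: G_def V_def X_def Z_def v1_def v2_def inner_diff_right inner_add_right
        power2_eq_square algebra_simps)
  have gain1: "integral {0..T} (\<lambda>t. (C \<bullet> (X t - \<phi> t))\<^sup>2) \<le> \<gamma>\<^sup>2 * integral {0..T} (\<lambda>t. (v1 t)\<^sup>2)"
    if "T \<ge> 0" for T
  proof (rule L2_gain_bound_on_interval[OF gain that contX(3)])
    show "X 0 - \<phi> 0 = 0" by (simp add: X_def ec_def es_def \<phi>(2))
    show "((\<lambda>t. X t - \<phi> t) has_vector_derivative A *v (X t - \<phi> t) + v1 t *\<^sub>R B) (at t within {0..T})"
      if "t \<in> {0..T}" for t
      using has_vector_derivative_diff[OF X' \<phi>'[OF that]]
      by (simp add: matrix_vector_mult_diff_distrib algebra_simps)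
  qed
  have gain2: "integral {0..T} (\<lambda>t. (C \<bullet> (Z t - \<psi> t))\<^sup>2) \<le> \<gamma>\<^sup>2 * integral {0..T} (\<lambda>t. (v2 t)\<^sup>2)"
    if "T \<ge> 0" for T
  proof (rule L2_gain_bound_on_interval[OF gain that contX(4)])
    show "Z 0 - \<psi> 0 = 0" by (simp add: Z_def ec_def es_def \<psi>(2))
    show "((\<lambda>t. Z t - \<psi> t) has_vector_derivative A *v (Z t - \<psi> t) + v2 t *\<^sub>R B) (at t within {0..T})"
      if "t \<in> {0..T}" for t
      using has_vector_derivative_diff[OF Z' \<psi>'[OF that]]
      by (simp add: matrix_vector_mult_diff_distrib algebra_simps)
  qed
  define W where "W T = integral {0..T} (\<lambda>t. (exp (\<alpha> * t))\<^sup>2)" for T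
  \<comment> \<open>Here \<open>\<alpha> \<ge> 0\<close> enters; even on the imaginary axis the
    energy grows without bound.\<close>
  have W_ge: "W T \<ge> T" if "T \<ge> 0" for T
  proof -
    have "integral {0..T} (\<lambda>t. 1) \<le> W T" unfolding W_def
      using \<open>\<alpha> \<ge> 0\<close>
      by (intro integral_le integrable_continuous_interval continuous_intros) (auto simp: one_le_power)
    then show ?thesis using that by simp
  qed
  \<comment> \<open>A fraction \<open>1 - s\<close> of the output energy is sacrificed to absorb the
    cross terms between mode and transient; afterwards \<open>s\<close> tends to 1.\<close>
  have "s * G \<le> \<gamma>\<^sup>2 * V" if s: "0 < s" "s < 1" for s
  proof (rule ccontr)
    assume less: "\<not> s * G \<le> \<gamma>\<^sup>2 * V"
    define d e where "d = s * G - \<gamma>\<^sup>2 * V" and "e = 1 - s"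
    have d: "d > 0" and e: "e > 0" "s = 1 - e" using less s by (auto simp: d_def e_def)
    \<comment> \<open>The difference of the two sides is
      \<open>(e * p - q)^2 / e + q^2\<close>.\<close>
    have pq: "s * p\<^sup>2 - q\<^sup>2 / e \<le> (p - q)\<^sup>2" for p q
    proof -
      have "(p - q)\<^sup>2 - (s * p\<^sup>2 - q\<^sup>2 / e) = (e * p - q)\<^sup>2 / e + q\<^sup>2"
        using e(1) unfolding e(2) by (simp add: field_simps power2_eq_square)
      then show ?thesis using e by (smt (verit) divide_nonneg_pos zero_le_power2)
    qed
    define M where "M = (M1 + M2) / e"
    have "d * T \<le> M" if T: "T \<ge> 0" for T
    proof -
      have "s * G * W T - (integral {0..T} (\<lambda>t. (C \<bullet> \<phi> t)\<^sup>2) + integral {0..T} (\<lambda>t. (C \<bullet> \<psi> t)\<^sup>2)) / e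
          = integral {0..T} (\<lambda>t. s * G * (exp (\<alpha> * t))\<^sup>2 - ((C \<bullet> \<phi> t)\<^sup>2 + (C \<bullet> \<psi> t)\<^sup>2) / e)"
        unfolding W_def
        by (subst integral_diff, (intro integrable_continuous_interval continuous_intros cont\<phi> cont\<psi>; use e in simp)+,
            subst integral_divide, subst integral_add)
           (auto intro!: integrable_continuous_interval continuous_intros cont\<phi> cont\<psi>)
      also have "\<dots> \<le> integral {0..T} (\<lambda>t. (C \<bullet> (X t - \<phi> t))\<^sup>2 + (C \<bullet> (Z t - \<psi> t))\<^sup>2)"
      proof (intro integral_le integrable_continuous_interval continuous_intros cont\<phi> cont\<psi> contX)
        fix t
        show "s * G * (exp (\<alpha> * t))\<^sup>2 - ((C \<bullet> \<phi> t)\<^sup>2 + (C \<bullet> \<psi> t)\<^sup>2) / e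
            \<le> (C \<bullet> (X t - \<phi> t))\<^sup>2 + (C \<bullet> (Z t - \<psi> t))\<^sup>2"
          using pq[of "C \<bullet> X t" "C \<bullet> \<phi> t"] pq[of "C \<bullet> Z t" "C \<bullet> \<psi> t"]
          unfolding mult.assoc energy_out[symmetric]
          by (simp add: inner_diff_right add_divide_distrib distrib_left)
      qed (use e in auto)
      also have "\<dots> = integral {0..T} (\<lambda>t. (C \<bullet> (X t - \<phi> t))\<^sup>2) + integral {0..T} (\<lambda>t. (C \<bullet> (Z t - \<psi> t))\<^sup>2)"
        by (intro integral_add integrable_continuous_interval continuous_intros cont\<phi> cont\<psi> contX)
      also have "\<dots> \<le> \<gamma>\<^sup>2 * (integral {0..T} (\<lambda>t. (v1 t)\<^sup>2) + integral {0..T} (\<lambda>t. (v2 t)\<^sup>2))"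
        using gain1[OF T] gain2[OF T] by (simp add: distrib_left)
      also have "integral {0..T} (\<lambda>t. (v1 t)\<^sup>2) + integral {0..T} (\<lambda>t. (v2 t)\<^sup>2) = V * W T"
        unfolding W_def integral_mult_right[symmetric] energy_in[symmetric]
        by (intro integral_add[symmetric] integrable_continuous_interval continuous_intros contX)
      finally have "d * W T \<le> (integral {0..T} (\<lambda>t. (C \<bullet> \<phi> t)\<^sup>2) + integral {0..T} (\<lambda>t. (C \<bullet> \<psi> t)\<^sup>2)) / e"
        by (simp add: d_def algebra_simps)
      also have "\<dots> \<le> M"
        unfolding M_def using \<phi>(3)[OF T] \<psi>(3)[OF T] e by (intro divide_right_mono add_mono) auto
      finally have "d * W T \<le> M" .
      moreover have "d * T \<le> d * W T" using W_ge[OF T] d by simp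
      ultimately show ?thesis by linarith
    qed
    \<comment> \<open>At this time the bound would read
      \<open>\<bar>M\<bar> + 1 \<le> M\<close>.\<close>
    from this[of "(\<bar>M\<bar> + 1) / d"] show False using d by simp
  qed
  then show ?thesis unfolding G_def V_def by (rule field_le_mult_one_interval)
qed

section \<open>Spectral radius of nonnegative matrices\<close>

text \<open>At a largest coordinate of an eigenvector the row sum of absolute values bounds the
  eigenvalue. Boundedness is what makes the supremum in \<open>spectral_radius\<close> an upper
  bound for every eigenvalue.\<close>

lemma bdd_above_spectrum: "bdd_above (cmod ` spectrum M)"
proof (rule bdd_aboveI2)
  fix \<mu> assume "\<mu> \<in> spectrum M"
  then obtain x where "x \<noteq> 0" and x: "map_matrix complex_of_real M *v x = \<mu> *s x"
    by (auto simp: spectrum_def)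
  have "Max (range (\<lambda>i. norm (x $ i))) \<in> range (\<lambda>i. norm (x $ i))"
    by (intro Max_in) auto
  then obtain k where "Max (range (\<lambda>i. norm (x $ i))) = norm (x $ k)" by blast
  then have k: "norm (x $ i) \<le> norm (x $ k)" for i
    by (metis Max_ge finite finite_imageI rangeI)
  have "x $ k \<noteq> 0"
    using \<open>x \<noteq> 0\<close> k by (auto simp: vec_eq_iff)
  have "\<mu> * x $ k = (\<Sum>j\<in>UNIV. complex_of_real (M $ k $ j) * x $ j)"
    using arg_cong[OF x, of "\<lambda>v. v $ k"] by (simp add: matrix_vector_mult_def map_matrix_def)
  then have "cmod \<mu> * norm (x $ k) = norm (\<Sum>j\<in>UNIV. complex_of_real (M $ k $ j) * x $ j)"
    by (metis norm_mult)
  also have "\<dots> \<le> (\<Sum>j\<in>UNIV. \<bar>M $ k $ j\<bar> * norm (x $ k))"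
    using k by (intro sum_norm_le) (simp add: norm_mult mult_left_mono)
  also have "\<dots> = (\<Sum>j\<in>UNIV. \<bar>M $ k $ j\<bar>) * norm (x $ k)" by (simp add: sum_distrib_right)
  finally have "cmod \<mu> \<le> (\<Sum>j\<in>UNIV. \<bar>M $ k $ j\<bar>)" using \<open>x $ k \<noteq> 0\<close> by simp
  also have "\<dots> \<le> (\<Sum>i\<in>UNIV. \<Sum>j\<in>UNIV. \<bar>M $ i $ j\<bar>)"
    by (rule member_le_sum[where f = "\<lambda>i. \<Sum>j\<in>UNIV. \<bar>M $ i $ j\<bar>"]) (auto intro: sum_nonneg)
  finally show "cmod \<mu> \<le> (\<Sum>i\<in>UNIV. \<Sum>j\<in>UNIV. \<bar>M $ i $ j\<bar>)" .
qed

text \<open>If \<open>M\<close> had spectral radius below 1, then \<open>M - I\<close> would be Hurwitz, and small Euler steps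
  of its flow would contract the Lyapunov norm; but they do not decrease \<open>w\<close>.\<close>

lemma spectral_radius_ge_1:
  fixes M :: "real^'v^'v" and w :: "real^'v"
  assumes M: "\<And>i j. M $ i $ j \<ge> 0" and w: "\<And>i. w $ i \<ge> 0" "w \<noteq> 0"
    and sub: "\<And>i. w $ i \<le> (M *v w) $ i"
  shows "spectral_radius M \<ge> 1"
proof (rule ccontr)
  assume "\<not> spectral_radius M \<ge> 1"
  then have lt1: "cmod \<mu> < 1" if "\<mu> \<in> spectrum M" for \<mu>
    using cSUP_upper[OF that bdd_above_spectrum] by (simp add: spectral_radius_def)
  define N where "N x = M *v x - x" for x
  have lin: "linear N"
    unfolding N_def by (intro linear_compose_sub) (simp_all add: linear_ident)
  have "Re \<mu> < 0" if "complex_eigenvalue N \<mu>" for \<mu>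
  proof -
    have "complex_eigenvalue (\<lambda>x. M *v x) (\<mu> + 1)"
      using that
      by (auto simp: complex_eigenvalue_def cmap_def cscale_def N_def algebra_simps diff_eq_eq)
    then have "cmod (\<mu> + 1) < 1" using lt1 complex_eigenvalue_in_spectrum by blast
    then show ?thesis using complex_Re_le_cmod[of "\<mu> + 1"] by simp
  qed
  then obtain B a where B: "a > 0" "bounded_bilinear B" "symmetric_form B"
    "\<And>x. (norm x)\<^sup>2 \<le> B x x" "\<And>x. B x (N x) \<le> - a * B x x"
    using quadratic_lyapunov_function[OF lin] by blast
  interpret B: bounded_bilinear B by (rule B(2))
  obtain K1 where K1: "K1 > 0" "\<And>x. norm (N x) \<le> norm x * K1"
    using bounded_linear.pos_bounded[of N] lin linear_conv_bounded_linear by blast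
  obtain K2 where K2: "K2 > 0" "\<And>x y. norm (B x y) \<le> norm x * norm y * K2"
    using B.pos_bounded by blast
  define K where "K = K1\<^sup>2 * K2"
  have K: "K > 0" using K1 K2 by (simp add: K_def)
  have BN: "B (N x) (N x) \<le> K * B x x" for x
  proof -
    have "B (N x) (N x) \<le> (norm (N x))\<^sup>2 * K2"
      using K2(2)[of "N x" "N x"] by (simp add: power2_eq_square)
    also have "\<dots> \<le> (norm x * K1)\<^sup>2 * K2"
      using K1 K2 by (intro mult_right_mono power_mono) auto
    also have "\<dots> = K * (norm x)\<^sup>2" by (simp add: K_def power_mult_distrib)
    also have "\<dots> \<le> K * B x x" using B(4) K by (intro mult_left_mono) auto
    finally show ?thesis .
  qed
  \<comment> \<open>\<open>h \<le> 1\<close> makes the Euler step \<open>(1 - h) I + h M\<close>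
    entrywise nonnegative. \<open>h * K \<le> a\<close> lets the second order term cost only half of
    the decay \<open>2 * h * a\<close>, which leaves the factor \<open>1 - h * a\<close>, and
    \<open>h * a \<le> 1\<close> keeps that factor nonnegative.\<close>
  define h where "h = min 1 (min (a / K) (1 / a))"
  have h: "h > 0" "h \<le> 1" "h * K \<le> a" "h * a \<le> 1"
    using B(1) K by (auto simp: h_def simp flip: pos_le_divide_eq)
  define q where "q = 1 - h * a"
  have q: "0 \<le> q" "q < 1" using h B(1) by (auto simp: q_def)
  define \<Phi> where "\<Phi> x = x + h *\<^sub>R N x" for x
  have step: "B (\<Phi> x) (\<Phi> x) \<le> q * B x x" for x
  proof -
    have "B (\<Phi> x) (\<Phi> x) = B x x + 2 * h * B x (N x) + h * (h * B (N x) (N x))"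
      using B(3) unfolding symmetric_form_def
      by (simp add: \<Phi>_def B.add_left B.add_right B.scaleR_left B.scaleR_right)
    also have "h * (h * B (N x) (N x)) \<le> h * (h * (K * B x x))"
      using h BN by (intro mult_left_mono) auto
    also have "\<dots> \<le> h * (a * B x x)"
      using h order_trans[OF zero_le_power2 B(4)[of x]]
      by (intro mult_left_mono, subst mult.assoc[symmetric], intro mult_right_mono) auto
    also have "2 * h * B x (N x) \<le> 2 * h * (- a * B x x)"
      using h B(5) by (intro mult_left_mono) auto
    finally show ?thesis by (simp add: q_def algebra_simps)
  qed
  \<comment> \<open>If \<open>w\<close> lies below \<open>x\<close>, it lies below
    \<open>M w\<close>, hence below \<open>M x\<close>, and so below the convex combination that is
    the Euler step.\<close>
  have "(\<forall>i. w $ i \<le> (\<Phi> ^^ k) w $ i) \<and> B ((\<Phi> ^^ k) w) ((\<Phi> ^^ k) w) \<le> q ^ k * B w w" for k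
  proof (induction k)
    case 0
    show ?case by simp
  next
    case (Suc k)
    define x where "x = (\<Phi> ^^ k) w"
    have x: "w $ i \<le> x $ i" "B x x \<le> q ^ k * B w w" for i using Suc by (auto simp: x_def)
    have "w $ i \<le> \<Phi> x $ i" for i
    proof -
      have "w $ i \<le> (M *v w) $ i" by (rule sub)
      also have "\<dots> \<le> (M *v x) $ i"
        unfolding matrix_vector_mult_def using M x by (auto intro!: sum_mono mult_left_mono)
      finally have "h * w $ i \<le> h * (M *v x) $ i" using h by simp
      moreover have "(1 - h) * w $ i \<le> (1 - h) * x $ i" using h x by (intro mult_left_mono) auto
      ultimately show ?thesis by (simp add: \<Phi>_def N_def algebra_simps)
    qed
    moreover have "B (\<Phi> x) (\<Phi> x) \<le> q * (q ^ k * B w w)"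
      using step[of x] mult_left_mono[OF x(2) q(1)] by linarith
    ultimately show ?case by (simp add: x_def mult.assoc)
  qed
  then have iter: "w $ i \<le> (\<Phi> ^^ k) w $ i"
    "B ((\<Phi> ^^ k) w) ((\<Phi> ^^ k) w) \<le> q ^ k * B w w" for i k by auto
  have "(norm w)\<^sup>2 \<le> q ^ k * B w w" for k
  proof -
    have "norm w \<le> norm ((\<Phi> ^^ k) w)"
      using w(1) order_trans[OF iter(1)[of _ k] abs_ge_self]
      by (intro norm_le_componentwise_cart) simp
    then have "(norm w)\<^sup>2 \<le> (norm ((\<Phi> ^^ k) w))\<^sup>2" by (intro power_mono) auto
    then show ?thesis using B(4)[of "(\<Phi> ^^ k) w"] iter(2)[of k] by linarith
  qed
  moreover have "(\<lambda>k. q ^ k * B w w) \<longlonglongrightarrow> 0"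
    using q by (intro tendsto_mult_left_zero LIMSEQ_realpow_zero) auto
  ultimately have "(norm w)\<^sup>2 \<le> 0" by (intro LIMSEQ_le_const) auto
  then show False using w(2) by simp
qed

section \<open>Linearization\<close>

text \<open>The constant holds on a whole neighbourhood, so the notion survives composition and
  restricts to a small closed ball, where the existence of solutions is obtained.\<close>

definition locally_lipschitz_at :: "('a::metric_space \<Rightarrow> 'b::metric_space) \<Rightarrow> 'a \<Rightarrow> bool" where
  "locally_lipschitz_at g x \<longleftrightarrow> (\<exists>L S. open S \<and> x \<in> S \<and> L-lipschitz_on S g)"

lemma locally_lipschitz_at_compose:
  assumes "locally_lipschitz_at g x" "locally_lipschitz_at f (g x)"
  shows "locally_lipschitz_at (\<lambda>y. f (g y)) x"
proof -
  obtain L S where S: "open S" "x \<in> S" "L-lipschitz_on S g"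
    using assms(1) by (auto simp: locally_lipschitz_at_def)
  obtain M R where R: "open R" "g x \<in> R" "M-lipschitz_on R f"
    using assms(2) by (auto simp: locally_lipschitz_at_def)
  have "open (S \<inter> g -` R)"
    by (rule continuous_open_preimage[OF lipschitz_on_continuous_on[OF S(3)] S(1) R(1)])
  moreover have "(M * L)-lipschitz_on (S \<inter> g -` R) (\<lambda>y. f (g y))"
    by (intro lipschitz_on_compose2 lipschitz_on_subset[OF S(3)] lipschitz_on_subset[OF R(3)]) auto
  ultimately show ?thesis
    unfolding locally_lipschitz_at_def using S(2) R(2) by (metis IntI vimageI)
qed

lemma locally_lipschitz_at_Pair:
  assumes "locally_lipschitz_at f x" "locally_lipschitz_at g x"
  shows "locally_lipschitz_at (\<lambda>y. (f y, g y)) x"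
proof -
  obtain L S where S: "open S" "x \<in> S" "L-lipschitz_on S f"
    using assms(1) by (auto simp: locally_lipschitz_at_def)
  obtain M R where R: "open R" "x \<in> R" "M-lipschitz_on R g"
    using assms(2) by (auto simp: locally_lipschitz_at_def)
  have "(sqrt (L\<^sup>2 + M\<^sup>2))-lipschitz_on (S \<inter> R) (\<lambda>y. (f y, g y))"
    by (intro lipschitz_on_Pair lipschitz_on_subset[OF S(3)] lipschitz_on_subset[OF R(3)]) auto
  then show ?thesis
    unfolding locally_lipschitz_at_def using S R by (meson IntI open_Int)
qed

lemma locally_lipschitz_at_linear:
  "bounded_linear f \<Longrightarrow> locally_lipschitz_at f x"
  unfolding locally_lipschitz_at_def
  by (metis UNIV_I bounded_linear.lipschitz_boundE open_UNIV)

lemma locally_lipschitz_at_vec: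
  fixes f :: "'i::finite \<Rightarrow> 'a::metric_space \<Rightarrow> 'b::real_normed_vector"
  assumes "\<And>i. locally_lipschitz_at (f i) x"
  shows "locally_lipschitz_at (\<lambda>y. \<chi> i. f i y) x"
proof -
  obtain L S where S: "\<And>i. open (S i)" "\<And>i. x \<in> S i" "\<And>i. (L i)-lipschitz_on (S i) (f i)"
    using assms unfolding locally_lipschitz_at_def by metis
  have "(\<Sum>i\<in>UNIV. L i)-lipschitz_on (\<Inter>i. S i) (\<lambda>y. \<chi> i. f i y)"
  proof (rule lipschitz_onI)
    fix y z assume "y \<in> (\<Inter>i. S i)" "z \<in> (\<Inter>i. S i)"
    then have "dist (f i y) (f i z) \<le> L i * dist y z" for i
      using lipschitz_onD[OF S(3)] by blast
    then have "(\<Sum>i\<in>UNIV. dist (f i y) (f i z)) \<le> (\<Sum>i\<in>UNIV. L i) * dist y z"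
      unfolding sum_distrib_right by (rule sum_mono)
    moreover have "dist (\<chi> i. f i y) (\<chi> i. f i z) \<le> (\<Sum>i\<in>UNIV. dist (f i y) (f i z))"
      unfolding dist_vec_def by (simp add: L2_set_le_sum)
    ultimately show "dist (\<chi> i. f i y) (\<chi> i. f i z) \<le> (\<Sum>i\<in>UNIV. L i) * dist y z" by linarith
  qed (auto intro: sum_nonneg lipschitz_on_nonneg[OF S(3)])
  moreover have "open (\<Inter>i. S i)" using S(1) by (intro open_INT) auto
  ultimately show ?thesis unfolding locally_lipschitz_at_def using S(2) by blast
qed

text \<open>Mean value inequality on a ball where the norm of the derivative exceeds its central
  value by less than 1.\<close>

lemma cont_differentiable_on_imp_lipschitz_at:
  assumes "cont_differentiable_on g D" "x \<in> D"
  shows "locally_lipschitz_at g x"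
proof -
  obtain W g' where W: "open W" "x \<in> W" "continuous_on W g'"
    "\<And>y. y \<in> W \<Longrightarrow> (g has_derivative blinfun_apply (g' y)) (at y)"
    using assms unfolding cont_differentiable_on_def by blast
  have "isCont (\<lambda>y. norm (g' y)) x"
    using W continuous_on_eq_continuous_at by (intro continuous_norm) blast
  then obtain d where d: "d > 0" "\<And>y. dist y x < d \<Longrightarrow> dist (norm (g' y)) (norm (g' x)) < 1"
    unfolding continuous_at_eps_delta by (metis dist_real_def zero_less_one)
  obtain e where e: "e > 0" "ball x e \<subseteq> W" using W openE by blast
  define r where "r = min d e"
  have "(norm (g' x) + 1)-lipschitz_on (ball x r) g"
  proof (rule lipschitz_onI)
    fix y z assume "y \<in> ball x r" "z \<in> ball x r"
    moreover have "(g has_derivative blinfun_apply (g' u)) (at u within ball x r)" if "u \<in> ball x r" for u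
    proof -
      have "u \<in> W" using that e(2) by (auto simp: r_def)
      then show ?thesis by (rule has_derivative_at_withinI[OF W(4)])
    qed
    moreover have "onorm (blinfun_apply (g' u)) \<le> norm (g' x) + 1" if "u \<in> ball x r" for u
    proof -
      have "dist (norm (g' u)) (norm (g' x)) < 1"
        using that by (intro d(2)) (simp add: r_def dist_commute)
      then show ?thesis
        unfolding norm_blinfun.rep_eq[symmetric] dist_real_def by linarith
    qed
    ultimately have "norm (g y - g z) \<le> (norm (g' x) + 1) * norm (y - z)"
      by (intro differentiable_bound[of "ball x r" g "\<lambda>u. blinfun_apply (g' u)"]) auto
    then show "dist (g y) (g z) \<le> (norm (g' x) + 1) * dist y z" by (simp add: dist_norm)
  qed simp
  then show ?thesis
    unfolding locally_lipschitz_at_def using d(1) e(1)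
    by (intro exI[of _ "norm (g' x) + 1"] exI[of _ "ball x r"]) (auto simp: r_def)
qed

lemma has_derivative_vec:
  fixes f :: "'i::finite \<Rightarrow> 'a::real_normed_vector \<Rightarrow> 'b::euclidean_space"
  assumes "\<And>i. (f i has_derivative f' i) (at x)"
  shows "((\<lambda>y. \<chi> i. f i y) has_derivative (\<lambda>h. \<chi> i. f' i h)) (at x)"
  using assms
  by (subst has_derivative_componentwise_within)
     (auto simp: Basis_vec_def inner_axis intro!: has_derivative_inner_left)

text \<open>The Lyapunov function of the linearization serves near \<open>p\<close>: half of its
  decay rate pays for the remainder of the linearization.\<close>

lemma linearized_stability:
  fixes F :: "'a::euclidean_space \<Rightarrow> 'a"
  assumes F': "(F has_derivative J) (at p)" and "F p = 0" and "locally_lipschitz_at F p"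
    and stable: "\<And>\<mu>. complex_eigenvalue J \<mu> \<Longrightarrow> Re \<mu> < 0"
  shows "locally_asymptotically_stable F UNIV p"
proof -
  have "linear J" using F' by (rule has_derivative_linear)
  then obtain B a where B: "a > 0" "bounded_bilinear B" "symmetric_form B"
    "\<And>x. (norm x)\<^sup>2 \<le> B x x" "\<And>x. B x (J x) \<le> - a * B x x"
    using quadratic_lyapunov_function[OF _ stable] by blast
  interpret B: bounded_bilinear B by (rule B(2))
  obtain K where K: "K > 0" "\<And>x y. norm (B x y) \<le> norm x * norm y * K"
    using B.pos_bounded by blast
  \<comment> \<open>A remainder of this relative size contributes at most
    \<open>K * a / (2 * K) = a / 2\<close> times the squared distance.\<close>
  have "a / (2 * K) > 0" using B(1) K(1) by simp
  then obtain d where d: "d > 0"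
    "\<And>y. norm (y - p) < d \<Longrightarrow> norm (F y - F p - J (y - p)) \<le> a / (2 * K) * norm (y - p)"
    using F' unfolding has_derivative_at_alt by blast
  obtain L S where S: "open S" "p \<in> S" "L-lipschitz_on S F"
    using assms(3) by (auto simp: locally_lipschitz_at_def)
  obtain e where e: "e > 0" "cball p e \<subseteq> S" using S open_contains_cball by blast
  \<comment> \<open>The remainder estimate holds on the open ball of radius \<open>d\<close>;
    halving makes room for a closed ball.\<close>
  define r where "r = min (d / 2) e"
  have r: "r > 0" "r < d" "r \<le> e" using d(1) e(1) by (auto simp: r_def)
  have dissipative: "B (x - p) (F x) \<le> - (a / 2) * B (x - p) (x - p)" if "x \<in> cball p r" for x
  proof -
    define R where "R = F x - J (x - p)"
    have R: "norm R \<le> a / (2 * K) * norm (x - p)"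
      using d(2)[of x] that r \<open>F p = 0\<close> by (simp add: R_def dist_norm norm_minus_commute)
    have "B (x - p) (F x) = B (x - p) (J (x - p)) + B (x - p) R"
      by (simp add: R_def B.diff_right)
    also have "B (x - p) R \<le> norm (x - p) * norm R * K" using K(2)[of "x - p" R] by simp
    also have "\<dots> \<le> norm (x - p) * (a / (2 * K) * norm (x - p)) * K"
      using R K(1) by (intro mult_right_mono mult_left_mono) auto
    also have "\<dots> = a / 2 * (norm (x - p))\<^sup>2" using K(1) by (simp add: power2_eq_square)
    also have "\<dots> \<le> a / 2 * B (x - p) (x - p)" using B(1,4) by (intro mult_left_mono) auto
    finally show ?thesis using B(5)[of "x - p"] by simp
  qed
  interpret quadratic_lyapunov B "a / 2" r p F
    using B(1) by (intro quadratic_lyapunov.intro r B dissipative) simp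
  have "L-lipschitz_on (cball p r) F"
    using e(2) r(3) by (intro lipschitz_on_subset[OF S(3)]) auto
  then show ?thesis using \<open>F p = 0\<close> by (rule locally_asymptotically_stable)
qed

section \<open>The network\<close>

lemma cont_differentiable_on_has_derivative:
  assumes "cont_differentiable_on g D" "x \<in> D"
  obtains g' where "(g has_derivative g') (at x)"
  using assms unfolding cont_differentiable_on_def by blast

text \<open>The total derivative splits over \<open>(dx, 0)\<close> and \<open>(0, du)\<close>. Its
  restrictions are derivatives of the two partial maps, and uniqueness identifies them with
  \<open>lin_A\<close> and \<open>lin_B\<close>.\<close>

lemma cell_field_has_derivative:
  fixes f :: "real^'n \<Rightarrow> real \<Rightarrow> real^'n"
  assumes "cont_differentiable_on (\<lambda>(x, u). f x u) (X \<times> U)" "x \<in> X" "u \<in> U"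
  shows "((\<lambda>(x, u). f x u) has_derivative (\<lambda>(dx, du). lin_A f x u *v dx + du *\<^sub>R lin_B f x u)) (at (x, u))"
proof -
  obtain D where D: "((\<lambda>(x, u). f x u) has_derivative D) (at (x, u))"
    using cont_differentiable_on_has_derivative[OF assms(1), of "(x, u)"] assms by blast
  interpret D: bounded_linear D using D by (rule has_derivative_bounded_linear)
  have D1: "((\<lambda>x'. f x' u) has_derivative (\<lambda>dx. D (dx, 0))) (at x)"
    using has_derivative_compose[OF has_derivative_Pair[OF has_derivative_ident has_derivative_const] D]
    by simp
  then have "((\<lambda>x'. f x' u) has_derivative (\<lambda>dx. lin_A f x u *v dx)) (at x)"
    unfolding lin_A_def by (metis differentiableI jacobian_works)
  then have A: "lin_A f x u *v dx = D (dx, 0)" for dx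
    using has_derivative_unique[OF _ D1] by metis
  have D2: "((\<lambda>u'. f x u') has_derivative (\<lambda>du. D (0, du))) (at u)"
    using has_derivative_compose[OF has_derivative_Pair[OF has_derivative_const has_derivative_ident] D]
    by simp
  have D0: "D (0, du) = du *\<^sub>R D (0, 1)" for du
    using D.scaleR[of du "(0, 1)"] by simp
  have "((\<lambda>u'. f x u') has_vector_derivative D (0, 1)) (at u)"
    unfolding has_vector_derivative_def D0[symmetric] by (rule D2)
  then have B: "lin_B f x u = D (0, 1)"
    unfolding lin_B_def by (rule vector_derivative_at)
  have "D (dx, du) = lin_A f x u *v dx + du *\<^sub>R lin_B f x u" for dx du
    unfolding A B D0[symmetric] using D.add[of "(dx, 0)" "(0, du)"] by simp
  then have "D = (\<lambda>(dx, du). lin_A f x u *v dx + du *\<^sub>R lin_B f x u)" by auto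
  with D show ?thesis by simp
qed

lemma cell_output_has_derivative:
  fixes h :: "real^'n \<Rightarrow> real"
  assumes "cont_differentiable_on h X" "x \<in> X"
  shows "(h has_derivative (\<lambda>dx. lin_C h x \<bullet> dx)) (at x)"
proof -
  obtain D where D: "(h has_derivative D) (at x)"
    using cont_differentiable_on_has_derivative[OF assms] by blast
  interpret D: bounded_linear D using D by (rule has_derivative_bounded_linear)
  have "D dx = lin_C h x \<bullet> dx" for dx
  proof -
    have "D dx = D (\<Sum>i\<in>UNIV. (dx $ i) *\<^sub>R axis i 1)"
      using basis_expansion[of dx] by (simp add: scalar_mult_eq_scaleR)
    also have "\<dots> = (\<Sum>i\<in>UNIV. dx $ i * D (axis i 1))" by (simp add: D.sum D.scaleR)
    also have "\<dots> = lin_C h x \<bullet> dx"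
      by (simp add: lin_C_def inner_vec_def frechet_derivative_at[OF D, symmetric] mult.commute)
    finally show ?thesis .
  qed
  then have "D = (\<lambda>dx. lin_C h x \<bullet> dx)" by auto
  with D show ?thesis by simp
qed

definition network_jacobian ::
    "('v \<Rightarrow> real^'n^'n) \<Rightarrow> ('v \<Rightarrow> real^'n) \<Rightarrow> ('v \<Rightarrow> real^'n) \<Rightarrow> real^'v^'v \<Rightarrow> real^'n^'v \<Rightarrow> real^'n^'v::finite"
  where "network_jacobian A B C P \<xi> =
    (\<chi> i. A i *v (\<xi> $ i) + (P *v (\<chi> j. C j \<bullet> (\<xi> $ j))) $ i *\<^sub>R B i)"

lemma network_field_has_derivative:
  fixes f :: "real^'n \<Rightarrow> real \<Rightarrow> real^'n" and P :: "real^'v^'v"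
  assumes f: "cont_differentiable_on (\<lambda>(x, u). f x u) (X \<times> U)" and h: "cont_differentiable_on h X"
    and p: "\<And>i. p $ i \<in> X" "\<And>i. network_input h P p $ i \<in> U"
  shows "(network_field f h P has_derivative network_jacobian
      (\<lambda>i. lin_A f (p $ i) (network_input h P p $ i)) (\<lambda>i. lin_B f (p $ i) (network_input h P p $ i))
      (\<lambda>i. lin_C h (p $ i)) P) (at p)"
    and "locally_lipschitz_at (network_field f h P) p"
proof -
  have nth: "bounded_linear (\<lambda>x :: real^'n^'v. x $ i)" for i by (rule bounded_linear_vec_nth)
  have P: "bounded_linear (\<lambda>y. (P *v y) $ i)" for i
    using bounded_linear_compose[OF bounded_linear_vec_nth matrix_vector_mul_bounded_linear] by blast
  \<comment> \<open>Each component is written as the uncurried cell field after a pair, so that one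
    chain rule covers state and input.\<close>
  have field: "network_field f h P =
      (\<lambda>x. \<chi> i. (\<lambda>(x, u). f x u) (x $ i, (P *v (\<chi> j. h (x $ j))) $ i))"
    by (simp add: network_field_def network_input_def fun_eq_iff)
  have "((\<lambda>x. h (x $ j)) has_derivative (\<lambda>\<xi>. lin_C h (p $ j) \<bullet> (\<xi> $ j))) (at p)" for j
    by (rule has_derivative_compose[OF bounded_linear_imp_has_derivative[OF nth]
          cell_output_has_derivative[OF h p(1)]])
  then have "((\<lambda>x. \<chi> j. h (x $ j)) has_derivative (\<lambda>\<xi>. \<chi> j. lin_C h (p $ j) \<bullet> (\<xi> $ j))) (at p)"
    by (rule has_derivative_vec)
  then have u': "((\<lambda>x. (P *v (\<chi> j. h (x $ j))) $ i) has_derivative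
      (\<lambda>\<xi>. (P *v (\<chi> j. lin_C h (p $ j) \<bullet> (\<xi> $ j))) $ i)) (at p)" for i
    by (rule bounded_linear.has_derivative[OF P])
  have "((\<lambda>x. (\<lambda>(x, u). f x u) (x $ i, (P *v (\<chi> j. h (x $ j))) $ i)) has_derivative
      (\<lambda>\<xi>. (\<lambda>(dx, du). lin_A f (p $ i) (network_input h P p $ i) *v dx +
        du *\<^sub>R lin_B f (p $ i) (network_input h P p $ i))
        (\<xi> $ i, (P *v (\<chi> j. lin_C h (p $ j) \<bullet> (\<xi> $ j))) $ i))) (at p)" for i
    by (rule has_derivative_compose[OF has_derivative_Pair[OF bounded_linear_imp_has_derivative[OF nth] u']])
       (use cell_field_has_derivative[OF f p(1) p(2), of i i] in \<open>simp add: network_input_def\<close>)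
  then show "(network_field f h P has_derivative network_jacobian
      (\<lambda>i. lin_A f (p $ i) (network_input h P p $ i)) (\<lambda>i. lin_B f (p $ i) (network_input h P p $ i))
      (\<lambda>i. lin_C h (p $ i)) P) (at p)"
    unfolding field network_jacobian_def prod.case by (rule has_derivative_vec)
  have "locally_lipschitz_at (\<lambda>x. h (x $ j)) p" for j
    by (rule locally_lipschitz_at_compose[OF locally_lipschitz_at_linear[OF nth]
          cont_differentiable_on_imp_lipschitz_at[OF h p(1)]])
  then have "locally_lipschitz_at (\<lambda>x. \<chi> j. h (x $ j)) p"
    by (rule locally_lipschitz_at_vec)
  then have u: "locally_lipschitz_at (\<lambda>x. (P *v (\<chi> j. h (x $ j))) $ i) p" for i
    by (rule locally_lipschitz_at_compose[OF _ locally_lipschitz_at_linear[OF P]])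
  have "locally_lipschitz_at (\<lambda>x. (\<lambda>(x, u). f x u) (x $ i, (P *v (\<chi> j. h (x $ j))) $ i)) p" for i
    using p by (intro locally_lipschitz_at_compose[OF locally_lipschitz_at_Pair[OF
          locally_lipschitz_at_linear[OF nth] u]] cont_differentiable_on_imp_lipschitz_at[OF f])
       (simp add: network_input_def)
  then show "locally_lipschitz_at (network_field f h P) p"
    unfolding field by (rule locally_lipschitz_at_vec)
qed

lemma network_jacobian_stable:
  fixes P \<Gamma> :: "real^'v^'v"
  assumes hurwitz: "\<And>i. hurwitz (A i)" and gain: "\<And>i. L2_gain_bound (A i) (B i) (C i) (g i)"
    and P: "\<And>i j. P $ i $ j \<ge> 0" and \<Gamma>: "\<Gamma> = (\<chi> i j. if i = j then g i else 0)"
    and radius: "spectral_radius (P ** \<Gamma>) < 1"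
    and "complex_eigenvalue (network_jacobian A B C P) \<mu>"
  shows "Re \<mu> < 0"
proof (rule ccontr)
  assume "\<not> Re \<mu> < 0"
  then have Re: "Re \<mu> \<ge> 0" by simp
  obtain x y where xy: "(x, y) \<noteq> 0"
    "network_jacobian A B C P x = Re \<mu> *\<^sub>R x - Im \<mu> *\<^sub>R y"
    "network_jacobian A B C P y = Im \<mu> *\<^sub>R x + Re \<mu> *\<^sub>R y"
    using assms(6) by (auto simp: complex_eigenvalue_def cmap_def cscale_def)
  define u v where "u = P *v (\<chi> j. C j \<bullet> (x $ j))" and "v = P *v (\<chi> j. C j \<bullet> (y $ j))"
  have mode: "A i *v (x $ i) + u $ i *\<^sub>R B i = Re \<mu> *\<^sub>R (x $ i) - Im \<mu> *\<^sub>R (y $ i)"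
    "A i *v (y $ i) + v $ i *\<^sub>R B i = Im \<mu> *\<^sub>R (x $ i) + Re \<mu> *\<^sub>R (y $ i)" for i
    using arg_cong[OF xy(2), of "\<lambda>z. z $ i"] arg_cong[OF xy(3), of "\<lambda>z. z $ i"]
    by (simp_all add: network_jacobian_def u_def v_def)
  define q where "q i = Complex (C i \<bullet> (x $ i)) (C i \<bullet> (y $ i))" for i
  define w where "w = (\<chi> i. cmod (Complex (u $ i) (v $ i)))"
  have g: "g i \<ge> 0" for i using gain[of i] by (simp add: L2_gain_bound_def)
  have qw: "cmod (q i) \<le> g i * w $ i" for i
  proof -
    have "(cmod (q i))\<^sup>2 \<le> (g i * w $ i)\<^sup>2"
      using L2_gain_bound_eigenmode[OF hurwitz gain Re mode]
      by (simp add: q_def w_def cmod_power2 power_mult_distrib)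
    moreover have "g i * w $ i \<ge> 0" using g by (simp add: w_def)
    ultimately show ?thesis by (rule power2_le_imp_le)
  qed
  have "w $ i \<le> ((P ** \<Gamma>) *v w) $ i" for i
  proof -
    \<comment> \<open>The complex inputs are \<open>P\<close> applied to the complex outputs; since
      \<open>P\<close> is nonnegative, the triangle inequality keeps its entries.\<close>
    have "Complex (u $ i) (v $ i) = (\<Sum>j\<in>UNIV. P $ i $ j *\<^sub>R q j)"
      by (simp add: complex_eq_iff u_def v_def q_def matrix_vector_mult_def)
    then have "w $ i \<le> (\<Sum>j\<in>UNIV. P $ i $ j * (g j * w $ j))"
      unfolding w_def using P qw
      by (auto intro!: sum_norm_le mult_left_mono simp: w_def)
    also have "\<dots> = (P *v (\<Gamma> *v w)) $ i"
      by (simp add: matrix_vector_mult_def \<Gamma> if_distrib[of "\<lambda>a. a * _"] cong: if_cong)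
    finally show ?thesis by (simp add: matrix_vector_mul_assoc)
  qed
  moreover have "(P ** \<Gamma>) $ i $ j \<ge> 0" for i j
    using P g by (auto simp: matrix_matrix_mult_def \<Gamma> intro!: sum_nonneg)
  moreover have "w $ i \<ge> 0" for i by (simp add: w_def)
  ultimately have "w = 0"
    using spectral_radius_ge_1[of "P ** \<Gamma>" w] radius by force
  then have uv: "u $ i = 0" "v $ i = 0" for i
    by (simp_all add: w_def vec_eq_iff complex_eq_iff)
  \<comment> \<open>Without input every nonzero block of the eigenvector is an eigenvector of its
    own Hurwitz matrix.\<close>
  have "(x $ i, y $ i) = 0" for i
  proof (rule ccontr)
    assume "(x $ i, y $ i) \<noteq> 0"
    moreover have "cmap (\<lambda>z. A i *v z) (x $ i, y $ i) = cscale \<mu> (x $ i, y $ i)"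
      using mode[of i] uv[of i] by (simp add: cmap_def cscale_def)
    ultimately have "complex_eigenvalue (\<lambda>z. A i *v z) \<mu>"
      unfolding complex_eigenvalue_def by blast
    then show False
      using complex_eigenvalue_in_spectrum hurwitz[of i] Re unfolding hurwitz_def by fastforce
  qed
  then show False using xy(1) by (simp add: vec_eq_iff zero_prod_def)
qed

section \<open>Lifting the pattern from the quotient\<close>

lemma class_of_eqI: "vertex_partition Q \<Longrightarrow> k \<in> Q j \<Longrightarrow> class_of Q k = j"
  unfolding class_of_def vertex_partition_def disjoint_family_on_def by (intro the_equality) auto

lemma in_class_of: "vertex_partition Q \<Longrightarrow> k \<in> Q (class_of Q k)"
  using class_of_eqI[of Q k] unfolding vertex_partition_def by blast

text \<open>\<open>P\<close> preserves the vectors that are constant on classes and acts on them as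
  the quotient matrix, so solutions of the reduced equation lift to the network.\<close>

lemma equitable_pattern_input:
  fixes P :: "real^'v^'v" and Q :: "'r::finite \<Rightarrow> 'v::finite set"
  assumes Q: "equitable_with_quotient P Q R"
  shows "(P *v (\<chi> k. c (class_of Q k))) $ i = (R *v (\<chi> j. c j)) $ class_of Q i"
proof -
  have part: "vertex_partition Q" using Q by (simp add: equitable_with_quotient_def)
  have "(P *v (\<chi> k. c (class_of Q k))) $ i = (\<Sum>k\<in>(\<Union>j. Q j). P $ i $ k * c (class_of Q k))"
    using part by (simp add: matrix_vector_mult_def vertex_partition_def)
  also have "\<dots> = (\<Sum>j\<in>UNIV. \<Sum>k\<in>Q j. P $ i $ k * c (class_of Q k))"
    using part by (intro sum.UNION_disjoint) (auto simp: vertex_partition_def disjoint_family_on_def)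
  also have "\<dots> = (\<Sum>j\<in>UNIV. (\<Sum>k\<in>Q j. P $ i $ k) * c j)"
    by (simp add: class_of_eqI[OF part] sum_distrib_right)
  also have "\<dots> = (\<Sum>j\<in>UNIV. R $ class_of Q i $ j * c j)"
    using Q in_class_of[OF part, of i] by (intro sum.cong) (auto simp: equitable_with_quotient_def)
  finally show ?thesis by (simp add: matrix_vector_mult_def)
qed

theorem theoremV1:
  fixes E :: "('v::finite \<times> 'v) set" and w P :: "real^'v^'v"
    and f :: "real^'n \<Rightarrow> real \<Rightarrow> real^'n" and h :: "real^'n \<Rightarrow> real"
    and X :: "(real^'n) set" and U Y :: "real set"
    and S :: "real \<Rightarrow> real^'n" and T :: "real \<Rightarrow> real"
    and Q :: "'r::finite \<Rightarrow> 'v set" and Pbar :: "real^'r^'r" and z :: "real^'r"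
    and \<gamma> :: "'r \<Rightarrow> real"
  assumes "contact_graph E w"
    and "P = scaled_adjacency w"
    and "cell_system f h X U Y S T"
    and "\<And>x i. x \<in> network_states X \<Longrightarrow> network_input h P x $ i \<in> U"
    and "equitable_with_quotient P Q Pbar"
    and "\<And>j. z $ j \<in> U"
    and "z = Pbar *v (\<chi> j. T (z $ j))"
    and "\<And>j. hurwitz (lin_A f (S (z $ j)) (z $ j))"
    and "\<And>j. observable (lin_A f (S (z $ j)) (z $ j)) (lin_C h (S (z $ j)))"
    and "\<And>j. is_L2_gain (lin_A f (S (z $ j)) (z $ j)) (lin_B f (S (z $ j)) (z $ j))
               (lin_C h (S (z $ j))) (\<gamma> j)"
    and "spectral_radius (P ** gain_matrix Q \<gamma>) < 1"
  shows "locally_asymptotically_stable (network_field f h P) UNIV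
           (\<chi> i. S (z $ class_of Q i))"
proof -
  define p where "p = (\<chi> i. S (z $ class_of Q i))"
  have cell: "cont_differentiable_on (\<lambda>(x, u). f x u) (X \<times> U)" "cont_differentiable_on h X"
    using assms(3) by (simp_all add: cell_system_def)
  have equilibrium: "S (z $ j) \<in> X" "f (S (z $ j)) (z $ j) = 0" "h (S (z $ j)) = T (z $ j)" for j
    using assms(3) assms(6)[of j]
    by (auto simp: cell_system_def globally_asymptotically_stable_def stable_equilibrium_def)
  \<comment> \<open>The outputs at the pattern are constant on classes with values
    \<open>T (z $ j)\<close>, so the reduced equation returns exactly the inputs that sustain the
    pattern.\<close>
  have input: "network_input h P p $ i = z $ class_of Q i" for i
    using equitable_pattern_input[OF assms(5), of "\<lambda>j. T (z $ j)" i]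
    by (simp add: network_input_def p_def equilibrium flip: assms(7))
  have "P $ i $ j \<ge> 0" for i j
    using assms(1) by (simp add: assms(2) scaled_adjacency_def contact_graph_def less_imp_le)
  then have "Re \<mu> < 0" if "complex_eigenvalue (network_jacobian
      (\<lambda>i. lin_A f (p $ i) (network_input h P p $ i)) (\<lambda>i. lin_B f (p $ i) (network_input h P p $ i))
      (\<lambda>i. lin_C h (p $ i)) P) \<mu>" for \<mu>
    \<comment> \<open>\<open>input\<close> speaks of the folded \<open>p\<close>, so the inputs are
      rewritten before \<open>p\<close> is unfolded in the states.\<close>
    using assms(8,10,11)
    by (intro network_jacobian_stable[OF _ _ _ _ _ that, of "\<lambda>i. \<gamma> (class_of Q i)" "gain_matrix Q \<gamma>"])
       (simp_all add: input is_L2_gain_def gain_matrix_def, simp_all add: p_def)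
  moreover have "network_field f h P p = 0"
    by (simp add: network_field_def input vec_eq_iff) (simp add: p_def equilibrium)
  moreover have "p $ i \<in> X" "network_input h P p $ i \<in> U" for i
    using equilibrium assms(6) by (simp_all add: input) (simp add: p_def)
  ultimately show ?thesis
    unfolding p_def[symmetric]
    using linearized_stability network_field_has_derivative[OF cell] by blast
qed

end
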